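(* Let $k\ge 1$ and $m\ge 6$ be integers, and let $X$ and $X'$ be $\mathrm{WL}_m$-equivalent graphs. Then $X$ is isomorphic to a Cartesian product $X_1\,\square\cdots\square\,X_k$ of $k$ connected prime graphs if and only if $X'$ is isomorphic to a Cartesian product of $k$ connected prime graphs. (That is, the property "to be decomposable into a Cartesian product of $k$ connected prime graphs" is $\mathrm{WL}_m$-invariant for all $m\ge 6$.)
   Context: Graphs are finite, simple and undirected; a graph is $X=(\Omega,E)$ with $E\subseteq\Omega\times\Omega$ irreflexive and symmetric. The Cartesian product $X_1\,\square\cdots\square\,X_n$ of graphs $X_i=(\Omega_i,E_i)$ has vertex set $\Omega_1\times\cdots\times\Omega_n$, two vertices being adjacent iff they differ in exactly one coordinate $i$ and their $i$-th coordinates are adjacent in $X_i$. A graph $X$ is prime if whenever $X$ is isomorphic to $X_1\,\square\cdots\square\,X_n$ with every $X_i$ having at least two vertices, then $n=1$. For $m\ge 2$, the $m$-dimensional Weisfeiler–Leman algorithm assigns to a graph $X$ with vertex set $\Omega$ a canonical partition $\mathrm{WL}_m(X)$ of $\Omega^m$ (an $m$-ary coherent configuration in the sense of Babai). Two graphs $X,X'$ are $\mathrm{WL}_m$-equivalent if there is an algebraic isomorphism $\hat\psi:\mathrm{WL}_m(X)\to\mathrm{WL}_m(X')$ (a bijection between classes preserving all intersection numbers of these $m$-ary coherent configurations) such that the induced map on the projections to the first two coordinates sends the edge set of $X$ to the edge set of $X'$; equivalently, $X$ and $X'$ satisfy the same sentences of first-order logic with counting quantifiers using at most $m+1$ variables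 (the $m$-dimensional Weisfeiler–Leman algorithm does not distinguish them). *)

theory Defs
  imports "Graph_Theory.Graph_Theory" "HOL-Library.Disjoint_Sets"
begin

text \<open>
  A graph is a \<^typ>\<open>'a pair_pre_digraph\<close> with vertex set \<^const>\<open>pverts\<close> and edge set
  \<^const>\<open>parcs\<close> satisfying \<^locale>\<open>pair_graph\<close>: finite, loopless, symmetric.
  The empty graph is a graph; the library's \<^const>\<open>Digraph_Component.connected\<close> excludes it.
\<close>

definition graph_iso :: "'a pair_pre_digraph \<Rightarrow> 'b pair_pre_digraph \<Rightarrow> bool" where
  "graph_iso X Y \<longleftrightarrow> digraph_iso (with_proj X) (with_proj Y)"


section \<open>Cartesian products and prime graphs\<close>

definition cartesian_product :: "'a pair_pre_digraph list \<Rightarrow> 'a list pair_pre_digraph" where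
  "cartesian_product Xs =
    (let V = {x. length x = length Xs \<and> (\<forall>i<length Xs. x ! i \<in> pverts (Xs ! i))} in
     \<lparr> pverts = V,
       parcs = {(x, y). x \<in> V \<and> y \<in> V \<and>
         (\<exists>i<length Xs. (x ! i, y ! i) \<in> parcs (Xs ! i) \<and>
           (\<forall>j<length Xs. j \<noteq> i \<longrightarrow> x ! j = y ! j))} \<rparr>)"

text \<open>
  Quantifying over graphs on subsets of \<^typ>\<open>nat\<close> loses nothing, since every finite graph is
  isomorphic to one of these. The number of factors \<^term>\<open>length Ys\<close> may be \<open>0\<close>; the empty
  product is the one-vertex graph, so that, as usual, the one-vertex graph is not prime.
\<close>

definition prime_graph :: "'a pair_pre_digraph \<Rightarrow> bool" where
  "prime_graph X \<longleftrightarrow>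
    (\<forall>Ys :: nat pair_pre_digraph list.
      (\<forall>Y\<in>set Ys. pair_graph Y \<and> 2 \<le> card (pverts Y)) \<and> graph_iso X (cartesian_product Ys)
      \<longrightarrow> length Ys = 1)"

definition product_of_connected_primes :: "nat \<Rightarrow> 'a pair_pre_digraph \<Rightarrow> bool" where
  "product_of_connected_primes k X \<longleftrightarrow>
    (\<exists>Xs :: nat pair_pre_digraph list.
      length Xs = k \<and>
      (\<forall>Y\<in>set Xs. pair_graph Y \<and> Digraph_Component.connected (with_proj Y) \<and> prime_graph Y) \<and>
      graph_iso X (cartesian_product Xs))"


section \<open>\<open>m\<close>-ary coherent configurations\<close>

text \<open>Elements of \<open>V\<^sup>m\<close> are lists of length \<open>m\<close>; coordinates are indexed from \<open>0\<close>.\<close>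

definition tuples :: "nat \<Rightarrow> 'a set \<Rightarrow> 'a list set" where
  "tuples m V = {x. set x \<subseteq> V \<and> length x = m}"

definition tuple_act :: "nat \<Rightarrow> (nat \<Rightarrow> nat) \<Rightarrow> 'a list \<Rightarrow> 'a list" where
  "tuple_act m \<sigma> x = map (\<lambda>i. x ! \<sigma> i) [0..<m]"

definition subst_count :: "nat \<Rightarrow> 'a set \<Rightarrow> (nat \<Rightarrow> 'a list set) \<Rightarrow> 'a list \<Rightarrow> nat" where
  "subst_count m V C x = card {\<alpha> \<in> V. \<forall>i<m. x[i := \<alpha>] \<in> C i}"

text \<open>Only the values \<open>C 0, \<dots>, C (m - 1)\<close> of the family \<open>C\<close> matter here and below.\<close>

definition coherent_configuration :: "nat \<Rightarrow> 'a set \<Rightarrow> 'a list set set \<Rightarrow> bool" where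
  "coherent_configuration m V P \<longleftrightarrow>
    partition_on (tuples m V) P \<and>
    (\<forall>A\<in>P. \<forall>x\<in>A. \<forall>y\<in>A. \<forall>i<m. \<forall>j<m. x ! i = x ! j \<longleftrightarrow> y ! i = y ! j) \<and>
    (\<forall>A\<in>P. \<forall>\<sigma>. \<sigma> ` {..<m} \<subseteq> {..<m} \<longrightarrow> tuple_act m \<sigma> ` A \<in> P) \<and>
    (\<forall>A\<in>P. \<forall>C. (\<forall>i<m. C i \<in> P) \<longrightarrow>
      (\<forall>x\<in>A. \<forall>y\<in>A. subst_count m V C x = subst_count m V C y))"

definition intersection_number ::
    "nat \<Rightarrow> 'a set \<Rightarrow> 'a list set \<Rightarrow> (nat \<Rightarrow> 'a list set) \<Rightarrow> nat" where
  "intersection_number m V A C = (THE n. \<forall>x\<in>A. subst_count m V C x = n)"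

definition algebraic_isomorphism ::
    "nat \<Rightarrow> 'a set \<Rightarrow> 'a list set set \<Rightarrow> 'b set \<Rightarrow> 'b list set set \<Rightarrow>
     ('a list set \<Rightarrow> 'b list set) \<Rightarrow> bool" where
  "algebraic_isomorphism m V P V' P' \<phi> \<longleftrightarrow>
    bij_betw \<phi> P P' \<and>
    (\<forall>A\<in>P. \<forall>C. (\<forall>i<m. C i \<in> P) \<longrightarrow>
      intersection_number m V A C = intersection_number m V' (\<phi> A) (\<lambda>i. \<phi> (C i)))"


section \<open>The \<open>m\<close>-dimensional Weisfeiler-Leman algorithm\<close>

text \<open>
  A colouring of \<open>V\<^sup>m\<close> is represented by the equivalence relation ``same colour''. Initially a
  tuple is coloured by its isomorphism type; a round refines the colour of \<open>x\<close> by the multiset,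
  over all vertices \<open>\<alpha>\<close>, of the \<open>m\<close>-tuples of colours of \<open>x[0 := \<alpha>], \<dots>, x[m - 1 := \<alpha>]\<close>.
\<close>

definition wl_initial :: "nat \<Rightarrow> 'a pair_pre_digraph \<Rightarrow> 'a list rel" where
  "wl_initial m X = {(x, y). x \<in> tuples m (pverts X) \<and> y \<in> tuples m (pverts X) \<and>
    (\<forall>i<m. \<forall>j<m. (x ! i = x ! j \<longleftrightarrow> y ! i = y ! j) \<and>
      ((x ! i, x ! j) \<in> parcs X \<longleftrightarrow> (y ! i, y ! j) \<in> parcs X))}"

definition wl_refine :: "nat \<Rightarrow> 'a set \<Rightarrow> 'a list rel \<Rightarrow> 'a list rel" where
  "wl_refine m V R = {(x, y) \<in> R.
    \<forall>C. (\<forall>i<m. C i \<in> tuples m V // R) \<longrightarrow> subst_count m V C x = subst_count m V C y}"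

definition wl_round :: "nat \<Rightarrow> 'a pair_pre_digraph \<Rightarrow> nat \<Rightarrow> 'a list rel" where
  "wl_round m X r = (wl_refine m (pverts X) ^^ r) (wl_initial m X)"

text \<open>The rounds decrease and stabilise, so that their intersection is the stable colouring.\<close>

definition WL :: "nat \<Rightarrow> 'a pair_pre_digraph \<Rightarrow> 'a list set set" where
  "WL m X = tuples m (pverts X) // (\<Inter>r. wl_round m X r)"

definition pr2 :: "'a list set \<Rightarrow> 'a rel" where
  "pr2 A = (\<lambda>x. (x ! 0, x ! 1)) ` A"

text \<open>
  \<open>\<phi>\<close> induces the map \<open>pr2 A \<mapsto> pr2 (\<phi> A)\<close> between the sets of projections. The edge set of \<open>X\<close> is
  a union of such projections, and its image is the union of their images.
\<close>

definition wl_equivalent :: "nat \<Rightarrow> 'a pair_pre_digraph \<Rightarrow> 'b pair_pre_digraph \<Rightarrow> bool" where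
  "wl_equivalent m X X' \<longleftrightarrow>
    (\<exists>\<phi>. algebraic_isomorphism m (pverts X) (WL m X) (pverts X') (WL m X') \<phi> \<and>
      (\<Union>A\<in>{A \<in> WL m X. pr2 A \<subseteq> parcs X}. pr2 (\<phi> A)) = parcs X')"


section \<open>The output of the algorithm is a coherent configuration\<close>

lemma equiv_wl_initial: "equiv (tuples m (pverts X)) (wl_initial m X)"
proof (rule equivI)
  show "wl_initial m X \<subseteq> tuples m (pverts X) \<times> tuples m (pverts X)"
    unfolding wl_initial_def by blast
  show "refl_on (tuples m (pverts X)) (wl_initial m X)"
    unfolding wl_initial_def by (rule refl_onI) blast
  show "sym (wl_initial m X)"
    by (rule symI) (simp only: wl_initial_def mem_Collect_eq prod.case, metis)
  show "trans (wl_initial m X)"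
    by (rule transI) (simp only: wl_initial_def mem_Collect_eq prod.case, metis)
qed

lemma equiv_wl_refine:
  assumes "equiv (tuples m V) R"
  shows "equiv (tuples m V) (wl_refine m V R)"
proof (rule equivI)
  have "sym R" "trans R" using assms by (auto elim: equivE)
  show "wl_refine m V R \<subseteq> tuples m V \<times> tuples m V"
    using equiv_type[OF assms] by (auto simp: wl_refine_def)
  show "refl_on (tuples m V) (wl_refine m V R)"
    using assms by (auto simp: equiv_def refl_on_def wl_refine_def)
  show "sym (wl_refine m V R)"
  proof (rule symI)
    fix x y assume "(x, y) \<in> wl_refine m V R"
    then show "(y, x) \<in> wl_refine m V R"
      using symD[OF \<open>sym R\<close>] by (simp add: wl_refine_def)
  qed
  show "trans (wl_refine m V R)"
  proof (rule transI)
    fix x y z assume "(x, y) \<in> wl_refine m V R" "(y, z) \<in> wl_refine m V R"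
    then show "(x, z) \<in> wl_refine m V R"
      using transD[OF \<open>trans R\<close>, of x y z] by (simp add: wl_refine_def)
  qed
qed

lemma wl_round_0: "wl_round m X 0 = wl_initial m X"
  and wl_round_Suc: "wl_round m X (Suc r) = wl_refine m (pverts X) (wl_round m X r)"
  by (simp_all add: wl_round_def)

lemma equiv_wl_round: "equiv (tuples m (pverts X)) (wl_round m X r)"
  by (induction r) (auto simp: wl_round_0 wl_round_Suc equiv_wl_initial equiv_wl_refine)

lemma wl_round_stabilises:
  assumes "finite (pverts X)"
  obtains N where "(\<Inter>r. wl_round m X r) = wl_round m X N"
    and "wl_refine m (pverts X) (wl_round m X N) = wl_round m X N"
proof -
  let ?R = "wl_round m X"
  have dec: "?R (Suc r) \<subseteq> ?R r" for r
    by (auto simp: wl_round_Suc wl_refine_def)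
  have "finite (tuples m (pverts X))"
    unfolding tuples_def using finite_lists_length_eq[OF assms] .
  then have fin: "finite (?R r)" for r
    using equiv_type[OF equiv_wl_round] by (metis finite_SigmaI finite_subset)
  obtain N where N: "\<And>r. card (?R N) \<le> card (?R r)"
    using ex_has_least_nat[of "\<lambda>_. True" undefined "\<lambda>r. card (?R r)"] by auto
  have fix_N: "?R (Suc N) = ?R N"
    using N[of "Suc N"] dec[of N] fin by (metis card_seteq)
  have const: "?R (N + j) = ?R N" for j
    by (induction j) (use fix_N in \<open>auto simp: wl_round_Suc\<close>)
  have "?R N \<subseteq> ?R r" for r
  proof (cases "r \<le> N")
    case True
    then show ?thesis using lift_Suc_antimono_le[of ?R, OF dec] by blast
  next
    case False
    then show ?thesis using const[of "r - N"] by simp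
  qed
  then have "(\<Inter>r. ?R r) = ?R N" by blast
  with fix_N show ?thesis using that by (simp add: wl_round_Suc)
qed

lemma tuples_update: "x \<in> tuples m V \<Longrightarrow> a \<in> V \<Longrightarrow> x[i := a] \<in> tuples m V"
  unfolding tuples_def using set_update_subset_insert by fastforce

lemma tuples_nth: "x \<in> tuples m V \<Longrightarrow> i < m \<Longrightarrow> x ! i \<in> V"
  unfolding tuples_def by (auto dest: nth_mem)

lemma length_tuple_act [simp]: "length (tuple_act m \<sigma> x) = m"
  and nth_tuple_act [simp]: "i < m \<Longrightarrow> tuple_act m \<sigma> x ! i = x ! \<sigma> i"
  by (simp_all add: tuple_act_def)

lemma tuple_act_tuples:
  "x \<in> tuples m V \<Longrightarrow> \<sigma> ` {..<m} \<subseteq> {..<m} \<Longrightarrow> tuple_act m \<sigma> x \<in> tuples m V"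
  by (auto simp: tuple_act_def tuples_def image_subset_iff)

lemma tuple_act_comp:
  "\<rho> ` {..<m} \<subseteq> {..<m} \<Longrightarrow> tuple_act m \<rho> (tuple_act m \<tau> x) = tuple_act m (\<tau> \<circ> \<rho>) x"
  by (rule nth_equalityI) (auto simp: image_subset_iff)

text \<open>Compatibility of a colouring with the action of a map \<open>\<sigma>\<close>.\<close>
definition act_ok :: "nat \<Rightarrow> 'a list rel \<Rightarrow> (nat \<Rightarrow> nat) \<Rightarrow> bool" where
  "act_ok m R \<sigma> \<longleftrightarrow>
     (\<forall>(x, y)\<in>R. (tuple_act m \<sigma> x, tuple_act m \<sigma> y) \<in> R) \<and>
     (\<forall>x z. x \<in> Domain R \<longrightarrow> (tuple_act m \<sigma> x, z) \<in> R \<longrightarrow> (\<exists>y. (x, y) \<in> R \<and> tuple_act m \<sigma> y = z))"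

lemma act_ok_comp:
  assumes "act_ok m R \<tau>" "act_ok m R \<rho>" "\<rho> ` {..<m} \<subseteq> {..<m}"
  shows "act_ok m R (\<tau> \<circ> \<rho>)"
proof -
  have 1: "\<And>x y. (x, y) \<in> R \<Longrightarrow> (tuple_act m (\<tau> \<circ> \<rho>) x, tuple_act m (\<tau> \<circ> \<rho>) y) \<in> R"
    using assms unfolding act_ok_def tuple_act_comp[OF assms(3), symmetric] by blast
  have 2: "\<exists>y. (x, y) \<in> R \<and> tuple_act m (\<tau> \<circ> \<rho>) y = z"
    if x: "x \<in> Domain R" and z: "(tuple_act m (\<tau> \<circ> \<rho>) x, z) \<in> R" for x z
  proof -
    have "tuple_act m \<tau> x \<in> Domain R" using x assms(1) unfolding act_ok_def by blast
    then obtain w where "(tuple_act m \<tau> x, w) \<in> R" "tuple_act m \<rho> w = z"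
      using z assms(2) unfolding act_ok_def tuple_act_comp[OF assms(3), symmetric] by blast
    moreover from this obtain y where "(x, y) \<in> R" "tuple_act m \<tau> y = w"
      using x assms(1) unfolding act_ok_def by blast
    ultimately show ?thesis unfolding tuple_act_comp[OF assms(3), symmetric] by blast
  qed
  show ?thesis unfolding act_ok_def using 1 2 by blast
qed

lemma tuple_act_update:
  assumes "\<sigma> permutes {..<m}" "length x = m" "i < m"
  shows "(tuple_act m \<sigma> x)[i := a] = tuple_act m \<sigma> (x[\<sigma> i := a])"
proof (rule nth_equalityI)
  fix j assume "j < length ((tuple_act m \<sigma> x)[i := a])"
  then have j: "j < m" by simp
  have "\<sigma> i < m" "\<sigma> j < m"
    using assms(1,3) j by (meson lessThan_iff permutes_in_image)+
  moreover have "\<sigma> i = \<sigma> j \<longleftrightarrow> i = j" using permutes_inj[OF assms(1)] by (auto simp: inj_def)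
  ultimately show "(tuple_act m \<sigma> x)[i := a] ! j = tuple_act m \<sigma> (x[\<sigma> i := a]) ! j"
    using j assms by (auto simp: nth_list_update)
qed simp

lemma wl_round_permute:
  assumes "\<sigma> permutes {..<m}" "(x, y) \<in> wl_round m X r"
  shows "(tuple_act m \<sigma> x, tuple_act m \<sigma> y) \<in> wl_round m X r"
  using assms
proof (induction r arbitrary: x y \<sigma>)
  case 0
  have "\<sigma> ` {..<m} \<subseteq> {..<m}" using 0(1) by (simp add: permutes_image)
  then show ?case using 0(2)
    by (auto simp: wl_round_0 wl_initial_def tuple_act_tuples image_subset_iff)
next
  case (Suc r)
  let ?R = "wl_round m X r" and ?V = "pverts X" and ?T = "tuples m (pverts X)"
  let ?i = "inv \<sigma>"
  have i: "?i permutes {..<m}" using Suc.prems(1) by (rule permutes_inv)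
  have s: "\<sigma> ` {..<m} \<subseteq> {..<m}" "?i ` {..<m} \<subseteq> {..<m}"
    using Suc.prems(1) i by (simp_all add: permutes_image)
  have xy: "(x, y) \<in> ?R" using Suc.prems(2) by (simp add: wl_round_Suc wl_refine_def)
  have T: "x \<in> ?T" "y \<in> ?T" using xy equiv_type[OF equiv_wl_round] by blast+
  have inv1: "tuple_act m ?i (tuple_act m \<sigma> u) = u" if "u \<in> ?T" for u
    using that permutes_inverses[OF Suc.prems(1)] s
    by (intro nth_equalityI) (auto simp: tuples_def tuple_act_comp)
  have inv2: "tuple_act m \<sigma> (tuple_act m ?i u) = u" if "u \<in> ?T" for u
    using that permutes_inverses[OF Suc.prems(1)] s
    by (intro nth_equalityI) (auto simp: tuples_def tuple_act_comp)
  have cnt: "subst_count m ?V C (tuple_act m \<sigma> x) = subst_count m ?V C (tuple_act m \<sigma> y)"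
    if C: "\<forall>i<m. C i \<in> ?T // ?R" for C
  proof -
    define D where "D = (\<lambda>j. tuple_act m ?i ` C (?i j))"
    have D: "D j \<in> ?T // ?R" if j: "j < m" for j
    proof -
      have "?i j < m" using s j by auto
      then obtain u where u: "u \<in> ?T" "C (?i j) = ?R `` {u}"
        using C by (meson quotientE)
      have "D j = ?R `` {tuple_act m ?i u}"
      proof (intro set_eqI iffI)
        fix w assume "w \<in> D j"
        then show "w \<in> ?R `` {tuple_act m ?i u}"
          using u Suc.IH[OF i] by (auto simp: D_def)
      next
        fix w assume "w \<in> ?R `` {tuple_act m ?i u}"
        then have w: "(tuple_act m ?i u, w) \<in> ?R" by simp
        then have wT: "w \<in> ?T" using equiv_type[OF equiv_wl_round] by blast
        have "(u, tuple_act m \<sigma> w) \<in> ?R"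
          using Suc.IH[OF Suc.prems(1) w] inv2[OF u(1)] by simp
        then show "w \<in> D j" unfolding D_def u(2) using inv1[OF wT]
          by (metis ImageI image_eqI singletonI)
      qed
      then show ?thesis using tuple_act_tuples[OF u(1) s(2)] by (simp add: quotientI)
    qed
    have eq: "subst_count m ?V C (tuple_act m \<sigma> z) = subst_count m ?V D z" if z: "z \<in> ?T" for z
    proof -
      have "(\<forall>i<m. (tuple_act m \<sigma> z)[i := a] \<in> C i) \<longleftrightarrow> (\<forall>j<m. z[j := a] \<in> D j)"
        if a: "a \<in> ?V" for a
      proof -
        have *: "z[j := a] \<in> D j \<longleftrightarrow> (tuple_act m \<sigma> z)[?i j := a] \<in> C (?i j)" if j: "j < m" for j
        proof -
          have zj: "z[j := a] \<in> ?T" using z a by (rule tuples_update)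
          have j': "?i j < m" using s j by auto
          have e: "(tuple_act m \<sigma> z)[?i j := a] = tuple_act m \<sigma> (z[j := a])"
            using tuple_act_update[OF Suc.prems(1) _ j', of z a] z permutes_inverses[OF Suc.prems(1)]
            by (simp add: tuples_def)
          have CT: "C (?i j) \<subseteq> ?T"
            using C j' in_quotient_imp_subset[OF equiv_wl_round] by blast
          show ?thesis unfolding e D_def
          proof
            assume "z[j := a] \<in> tuple_act m ?i ` C (?i j)"
            then show "tuple_act m \<sigma> (z[j := a]) \<in> C (?i j)" using inv2 CT by auto
          next
            assume "tuple_act m \<sigma> (z[j := a]) \<in> C (?i j)"
            then show "z[j := a] \<in> tuple_act m ?i ` C (?i j)"
              using inv1[OF zj] by (metis image_eqI)
          qed
        qed
        show ?thesis
        proof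
          assume "\<forall>i<m. (tuple_act m \<sigma> z)[i := a] \<in> C i"
          then show "\<forall>j<m. z[j := a] \<in> D j" using * s by auto
        next
          assume h: "\<forall>j<m. z[j := a] \<in> D j"
          show "\<forall>i<m. (tuple_act m \<sigma> z)[i := a] \<in> C i"
          proof (intro allI impI)
            fix i assume "i < m"
            then have "\<sigma> i < m" using s by auto
            with * h show "(tuple_act m \<sigma> z)[i := a] \<in> C i"
              using permutes_inverses[OF Suc.prems(1)] by metis
          qed
        qed
      qed
      then show ?thesis unfolding subst_count_def by (metis (mono_tags, lifting))
    qed
    have "subst_count m ?V D x = subst_count m ?V D y"
      using Suc.prems(2) D by (auto simp: wl_round_Suc wl_refine_def)
    then show ?thesis using eq T by simp
  qed
  have "(tuple_act m \<sigma> x, tuple_act m \<sigma> y) \<in> ?R" using Suc.IH[OF Suc.prems(1) xy] .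
  then show ?case using cnt by (simp add: wl_round_Suc wl_refine_def)
qed

theorem coherent_configuration_WL:
  assumes "finite (pverts X)"
  shows "coherent_configuration m (pverts X) (WL m X)"
proof -
  let ?V = "pverts X" and ?T = "tuples m (pverts X)"
  obtain N where N: "(\<Inter>r. wl_round m X r) = wl_round m X N"
      "wl_refine m ?V (wl_round m X N) = wl_round m X N"
    using wl_round_stabilises[OF assms] .
  define R where "R = wl_round m X N"
  have W: "WL m X = ?T // R" by (simp add: WL_def N R_def)
  have eqv: "equiv ?T R" by (simp add: R_def equiv_wl_round)
  have sub0: "R \<subseteq> wl_initial m X" unfolding R_def N(1)[symmetric] using wl_round_0 by blast
  have cnt: "subst_count m ?V C x = subst_count m ?V C y"
    if "(x, y) \<in> R" "\<forall>i<m. C i \<in> ?T // R" for x y C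
  proof -
    have "(x, y) \<in> wl_refine m ?V R" using that(1) N(2) by (simp add: R_def)
    then show ?thesis using that(2) unfolding wl_refine_def by blast
  qed
  have RT: "x \<in> ?T" "y \<in> ?T" if "(x, y) \<in> R" for x y
    using that equiv_type[OF eqv] by blast+
  have ini: "x ! i = x ! j \<longleftrightarrow> y ! i = y ! j" if "(x, y) \<in> R" "i < m" "j < m" for x y i j
    using that sub0 by (auto simp: wl_initial_def)
  have lift: "\<exists>b\<in>?V. \<forall>i<m. (x[i := a], y[i := b]) \<in> R"
    if xy: "(x, y) \<in> R" and a: "a \<in> ?V" for x y a
  proof -
    define C where "C = (\<lambda>i. R `` {x[i := a]})"
    have C: "\<forall>i<m. C i \<in> ?T // R"
      using RT[OF xy] a by (auto simp: C_def intro!: quotientI tuples_update)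
    have "a \<in> {\<alpha> \<in> ?V. \<forall>i<m. x[i := \<alpha>] \<in> C i}"
      using a RT[OF xy] eqv by (auto simp: C_def equiv_def refl_on_def tuples_update)
    then have "subst_count m ?V C x > 0"
      unfolding subst_count_def using assms by (auto simp: card_gt_0_iff)
    then have "subst_count m ?V C y > 0" using cnt[OF xy C] by simp
    then obtain b where "b \<in> ?V" "\<forall>i<m. y[i := b] \<in> C i"
      unfolding subst_count_def by (auto simp: card_gt_0_iff)
    then show ?thesis by (auto simp: C_def)
  qed
  have sing: "act_ok m R (id(k := j))" if kj: "k < m" "j < m" "k \<noteq> j" for k j
  proof -
    have act: "tuple_act m (id(k := j)) x = x[k := x ! j]" if "x \<in> ?T" for x
      using that kj by (intro nth_equalityI) (auto simp: tuples_def nth_list_update)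
    have 1: "(x[k := x ! j], y[k := y ! j]) \<in> R" if xy: "(x, y) \<in> R" for x y
    proof -
      have T: "x \<in> ?T" "y \<in> ?T" using RT xy by auto
      obtain b where b: "b \<in> ?V" "\<forall>i<m. (x[i := x ! j], y[i := b]) \<in> R"
        using lift[OF xy tuples_nth[OF T(1) kj(2)]] by blast
      then have r: "(x[k := x ! j], y[k := b]) \<in> R" using kj by blast
      have "b = y ! j" using ini[OF r kj(1) kj(2)] T kj by (auto simp: tuples_def)
      then show ?thesis using r by simp
    qed
    have 2: "\<exists>y. (x, y) \<in> R \<and> tuple_act m (id(k := j)) y = z"
      if x: "x \<in> ?T" and z: "(x[k := x ! j], z) \<in> R" for x z
    proof -
      have zT: "z \<in> ?T" using RT z by auto
      obtain b where b: "b \<in> ?V" "\<forall>i<m. (x[k := x ! j, i := x ! k], z[i := b]) \<in> R"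
        using lift[OF z tuples_nth[OF x kj(1)]] by blast
      then have r: "(x, z[k := b]) \<in> R" using kj by (metis list_update_id list_update_overwrite)
      have "z ! k = z ! j" using ini[OF z kj(1,2)] x kj by (auto simp: tuples_def)
      then have "tuple_act m (id(k := j)) (z[k := b]) = z"
        using act[OF tuples_update[OF zT b(1)]] kj by (metis list_update_id list_update_overwrite nth_list_update_neq)
      with r show ?thesis by blast
    qed
    show ?thesis unfolding act_ok_def using 1 2 act RT by fastforce
  qed
  have perm: "act_ok m R \<sigma>" if \<sigma>: "\<sigma> permutes {..<m}" for \<sigma>
  proof -
    have i: "inv \<sigma> permutes {..<m}" using \<sigma> by (rule permutes_inv)
    have s: "\<sigma> ` {..<m} \<subseteq> {..<m}" "inv \<sigma> ` {..<m} \<subseteq> {..<m}"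
      using \<sigma> i by (simp_all add: permutes_image)
    have inv: "tuple_act m (inv \<sigma>) (tuple_act m \<sigma> u) = u" "tuple_act m \<sigma> (tuple_act m (inv \<sigma>) u) = u"
      if "u \<in> ?T" for u
      using that permutes_inverses[OF \<sigma>] s
      by (intro nth_equalityI; force simp: tuples_def tuple_act_comp)+
    have 2: "\<exists>y. (x, y) \<in> R \<and> tuple_act m \<sigma> y = z"
      if x: "x \<in> ?T" and z: "(tuple_act m \<sigma> x, z) \<in> R" for x z
      using wl_round_permute[OF i z[unfolded R_def]] inv x RT[OF z] unfolding R_def by metis
    show ?thesis unfolding act_ok_def
      using wl_round_permute[OF \<sigma>, of _ _ X N] 2 RT unfolding R_def by blast
  qed
  have act_eq: "act_ok m R \<sigma> \<longleftrightarrow> act_ok m R \<tau>" if "\<And>i. i < m \<Longrightarrow> \<sigma> i = \<tau> i" for \<sigma> \<tau>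
  proof -
    have "tuple_act m \<sigma> = (tuple_act m \<tau> :: 'a list \<Rightarrow> _)"
      using that by (auto simp: tuple_act_def)
    then show ?thesis by (simp add: act_ok_def)
  qed
  have all: "act_ok m R \<sigma>" if "\<sigma> ` {..<m} \<subseteq> {..<m}" for \<sigma>
    using that
  proof (induction "m - card (\<sigma> ` {..<m})" arbitrary: \<sigma> rule: less_induct)
    case less
    show ?case
    proof (cases "inj_on \<sigma> {..<m}")
      case True
      define \<tau> where "\<tau> = (\<lambda>i. if i < m then \<sigma> i else i)"
      have "inj_on \<tau> {..<m}" using True by (auto simp: \<tau>_def inj_on_def)
      moreover have "\<tau> ` {..<m} \<subseteq> {..<m}" using less.prems by (auto simp: \<tau>_def)
      ultimately have "bij_betw \<tau> {..<m} {..<m}"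
        by (simp add: bij_betw_def endo_inj_surj)
      then have "\<tau> permutes {..<m}" by (rule bij_imp_permutes) (simp add: \<tau>_def)
      then show ?thesis using perm act_eq[of \<sigma> \<tau>] by (simp add: \<tau>_def)
    next
      case False
      then obtain a b where ab: "a < m" "b < m" "a \<noteq> b" "\<sigma> a = \<sigma> b"
        by (auto simp: inj_on_def)
      have "card (\<sigma> ` {..<m}) < m"
        using False by (metis card_image_le card_lessThan eq_card_imp_inj_on finite_lessThan nat_less_le)
      then obtain c where c: "c < m" "c \<notin> \<sigma> ` {..<m}"
        using less.prems by (metis card_lessThan lessThan_iff less_irrefl subsetI subset_antisym)
      define \<tau> where "\<tau> = \<sigma>(b := c)"
      have im: "\<tau> ` {..<m} = insert c (\<sigma> ` {..<m})"
      proof -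
        have "\<sigma> ` {..<m} = \<sigma> ` ({..<m} - {b})"
        proof
          show "\<sigma> ` {..<m} \<subseteq> \<sigma> ` ({..<m} - {b})"
          proof
            fix v assume "v \<in> \<sigma> ` {..<m}"
            then obtain i where "i < m" "v = \<sigma> i" by auto
            then show "v \<in> \<sigma> ` ({..<m} - {b})"
              using ab by (intro image_eqI[of _ _ "if i = b then a else i"]) auto
          qed
        qed auto
        moreover have "\<tau> ` {..<m} = insert c (\<sigma> ` ({..<m} - {b}))"
          unfolding \<tau>_def using ab(2) by (auto simp: fun_upd_image)
        ultimately show ?thesis by simp
      qed
      have "card (\<tau> ` {..<m}) = Suc (card (\<sigma> ` {..<m}))" using c im by simp
      moreover have t: "\<tau> ` {..<m} \<subseteq> {..<m}" using im c less.prems by auto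
      ultimately have "act_ok m R \<tau>"
        using less.hyps[of \<tau>] \<open>card (\<sigma> ` {..<m}) < m\<close> by simp
      moreover have "(id(b := a)) ` {..<m} \<subseteq> {..<m}" using ab by auto
      ultimately have "act_ok m R (\<tau> \<circ> id(b := a))"
        using act_ok_comp sing[of b a] ab by blast
      moreover have "\<tau> \<circ> id(b := a) = \<sigma>" using ab by (auto simp: \<tau>_def)
      ultimately show ?thesis by simp
    qed
  qed
  have cls: "tuple_act m \<sigma> ` A \<in> ?T // R"
    if A: "A \<in> ?T // R" and s: "\<sigma> ` {..<m} \<subseteq> {..<m}" for A \<sigma>
  proof -
    obtain x where x: "x \<in> ?T" "A = R `` {x}" using A by (rule quotientE)
    have xD: "x \<in> Domain R" using x eqv by (auto simp: equiv_def refl_on_def)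
    have "tuple_act m \<sigma> ` A = R `` {tuple_act m \<sigma> x}"
      unfolding x using all[OF s] xD unfolding act_ok_def by blast
    then show ?thesis using quotientI[OF tuple_act_tuples[OF x(1) s]] by simp
  qed
  have part: "partition_on ?T (?T // R)"
    using eqv by (rule partition_on_quotient)
  have rel: "(x, y) \<in> R" if "A \<in> ?T // R" "x \<in> A" "y \<in> A" for A x y
    using in_quotient_imp_in_rel[OF eqv that(1)] that(2,3) by simp
  show ?thesis unfolding coherent_configuration_def W
  proof (intro conjI ballI allI impI)
    show "partition_on ?T (?T // R)" by (fact part)
    show "x ! i = x ! j \<longleftrightarrow> y ! i = y ! j"
      if "A \<in> ?T // R" "x \<in> A" "y \<in> A" "i < m" "j < m" for A x y i j
      using ini[OF rel[OF that(1-3)] that(4,5)] .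
    show "tuple_act m \<sigma> ` A \<in> ?T // R"
      if "A \<in> ?T // R" "\<sigma> ` {..<m} \<subseteq> {..<m}" for A \<sigma>
      using cls[OF that] .
    show "subst_count m ?V C x = subst_count m ?V C y"
      if "A \<in> ?T // R" "\<forall>i<m. C i \<in> ?T // R" "x \<in> A" "y \<in> A" for A C x y
      using cnt[OF rel[OF that(1,3,4)] that(2)] .
  qed
qed

lemma Un_pr2_edge_classes:
  assumes "pair_graph X" "m \<ge> 2"
  shows "\<Union>(pr2 ` {A \<in> WL m X. pr2 A \<subseteq> parcs X}) = parcs X"
proof
  interpret pair_graph X by fact
  let ?T = "tuples m (pverts X)"
  define R where "R = (\<Inter>r. wl_round m X r)"
  obtain N where N: "R = wl_round m X N"
    using wl_round_stabilises[OF pair_finite_verts] unfolding R_def by metis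
  have eqv: "equiv ?T R" unfolding N by (rule equiv_wl_round)
  have sub0: "R \<subseteq> wl_initial m X" unfolding R_def using wl_round_0 by blast
  show "parcs X \<subseteq> \<Union>(pr2 ` {A \<in> WL m X. pr2 A \<subseteq> parcs X})"
  proof
    fix e assume e: "e \<in> parcs X"
    define x where "x = fst e # replicate (m - 1) (snd e)"
    have x: "x \<in> ?T"
      using assms(2) e arc_fst_in_verts arc_snd_in_verts by (auto simp: x_def tuples_def)
    have xe: "(x ! 0, x ! 1) = e" using assms(2) by (simp add: x_def)
    let ?A = "R `` {x}"
    have "?A \<in> WL m X" using x by (auto simp: WL_def R_def intro: quotientI)
    moreover have "pr2 ?A \<subseteq> parcs X"
      using sub0 e xe assms(2) by (fastforce simp: pr2_def wl_initial_def)
    moreover have "x \<in> ?A" using eqv x by (auto simp: equiv_def refl_on_def)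
    then have "e \<in> pr2 ?A" using xe by (force simp: pr2_def)
    ultimately show "e \<in> \<Union>(pr2 ` {A \<in> WL m X. pr2 A \<subseteq> parcs X})" by blast
  qed
qed blast

end

theory Submission
  imports Defs
begin

text \<open>
  Following Feder and Imrich--Zerovnik, call arcs \<open>(x, y)\<close> and \<open>(u, v)\<close> of a connected graph related
  if \<open>d(x, u) + d(y, v) \<noteq> d(x, v) + d(y, u)\<close>, or if \<open>x = u\<close> is the only common neighbour of \<open>y\<close> and
  \<open>v\<close>. The classes of the equivalence relation generated in this way are exactly the arc sets of the
  prime factors: two adjacent arcs from different classes span a square whose opposite sides are
  related, so contracting all walks outside a class yields a factor, and conversely related arcs of
  a product point in the same direction. Hence a connected graph is a product of \<open>k\<close> connected primes
  iff it has \<open>k\<close> classes. Distances, the relation and its transitive closure are expressible with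
  counting quantifiers and seven variables (two arcs, an intermediate arc, and one more vertex), so
  \<open>WL\<^sub>m\<close>-equivalence with \<open>m \<ge> 6\<close> preserves connectedness and the sizes of all classes, hence their
  number.
\<close>

section \<open>Counting equivalence classes\<close>

text \<open>The number of prime factors is pinned down by counting: the number of classes is
  additive over Cartesian products and positive on connected graphs with at least two vertices, so,
  given a decomposition into as many factors as classes, being prime means having one class. This
  number is not itself a count of vertices or tuples; it is recovered from class sizes, because each
  class contributes exactly 1 to the sum, over all arcs, of the reciprocal size of the class of the
  arc. Counting logic enters as a bijective pebble game: tuples in classes matched by
  \<open>\<phi>\<close> are its positions, and a single bijection of vertices answers a substitution
  in every coordinate at once. The obstacle is that \<open>\<phi>\<close> is only assumed to
  preserve intersection numbers and the arcs seen in the first two coordinates; equality types and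
  arcs in other coordinates have to be recovered from that.\<close>

lemma ex_bij_betw_fibres:
  assumes "finite A" "finite B" "\<And>c. card {a \<in> A. F a = c} = card {b \<in> B. G b = c}"
  shows "\<exists>f. bij_betw f A B \<and> (\<forall>a\<in>A. G (f a) = F a)"
proof -
  have "\<exists>g. bij_betw g {a \<in> A. F a = c} {b \<in> B. G b = c}" for c
    using assms by (intro finite_same_card_bij) auto
  then have "\<exists>g. \<forall>c. bij_betw (g c) {a \<in> A. F a = c} {b \<in> B. G b = c}" by (intro choice allI)
  then obtain g where g: "\<And>c. bij_betw (g c) {a \<in> A. F a = c} {b \<in> B. G b = c}" by blast
  let ?f = "\<lambda>a. g (F a) a"
  have f: "?f a \<in> B \<and> G (?f a) = F a" if "a \<in> A" for a
    using bij_betw_apply[OF g[of "F a"], of a] that by simp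
  have "inj_on ?f A"
  proof (rule inj_onI)
    fix a b assume ab: "a \<in> A" "b \<in> A" "?f a = ?f b"
    then have "F a = F b" using f by metis
    then show "a = b"
      using ab bij_betw_imp_inj_on[OF g[of "F a"]] by (auto dest: inj_onD)
  qed
  moreover have "b \<in> ?f ` A" if "b \<in> B" for b
  proof -
    have "b \<in> g (G b) ` {a \<in> A. F a = G b}"
      using bij_betw_imp_surj_on[OF g[of "G b"]] that by simp
    then show ?thesis by force
  qed
  ultimately have "bij_betw ?f A B" using f by (auto simp: bij_betw_def)
  then show ?thesis using f by blast
qed

lemma bij_betw_restrict_pred:
  assumes "bij_betw f A B" "\<And>a. a \<in> A \<Longrightarrow> Q a \<longleftrightarrow> Q' (f a)"
  shows "bij_betw f {a \<in> A. Q a} {b \<in> B. Q' b}"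
  using assms by (auto simp: bij_betw_def inj_on_def)

text \<open>The elements of a class of size \<open>n\<close> contribute \<open>1 / n\<close> each,
  hence 1 together. The right-hand side only uses what is visible from single elements.\<close>

lemma card_quotient_eq_sum:
  assumes R: "equiv A R" and A: "finite A"
  shows "real (card (A // R)) = (\<Sum>e\<in>A. 1 / real (card (R `` {e})))"
proof -
  have fin: "finite c" if "c \<in> A // R" for c
    using that A in_quotient_imp_subset[OF R] finite_subset by blast
  have "(\<Sum>e\<in>A. 1 / real (card (R `` {e}))) = (\<Sum>e\<in>\<Union>(A // R). 1 / real (card (R `` {e})))"
    by (simp add: Union_quotient[OF R])
  also have "\<dots> = (\<Sum>c\<in>A // R. \<Sum>e\<in>c. 1 / real (card (R `` {e})))"
    using fin quotient_disj[OF R] by (subst sum.Union_disjoint) auto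
  also have "\<dots> = (\<Sum>c\<in>A // R. 1)"
  proof (rule sum.cong)
    fix c assume c: "c \<in> A // R"
    have "R `` {e} = c" if "e \<in> c" for e
      using c that R by (metis Image_singleton_iff equiv_class_eq_iff quotientE)
    then show "(\<Sum>e\<in>c. 1 / real (card (R `` {e}))) = 1"
      using in_quotient_imp_non_empty[OF R c] fin[OF c] by simp
  qed simp
  finally show ?thesis by simp
qed

text \<open>Equal class sizes at corresponding elements give equal sums of reciprocals. The
  bijection \<open>h\<close> may scatter a class over several classes, which is what happens when it
  comes from matching arcs one at a time.\<close>

lemma card_quotient_eqI:
  assumes R: "equiv A R" "finite A" and R': "equiv B R'" "finite B" and h: "bij_betw h A B"
    and card: "\<And>e. e \<in> A \<Longrightarrow> card (R `` {e}) = card (R' `` {h e})"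
  shows "card (A // R) = card (B // R')"
proof -
  have "real (card (A // R)) = (\<Sum>e\<in>A. 1 / real (card (R' `` {h e})))"
    using card by (simp add: card_quotient_eq_sum[OF R])
  also have "\<dots> = (\<Sum>q\<in>B. 1 / real (card (R' `` {q})))"
    using h by (rule sum.reindex_bij_betw)
  also have "\<dots> = real (card (B // R'))"
    by (simp add: card_quotient_eq_sum[OF R'])
  finally show ?thesis by simp
qed

lemma card_image_eq:
  assumes "\<And>x y. x \<in> D \<Longrightarrow> y \<in> D \<Longrightarrow> g x = g y \<longleftrightarrow> g' x = g' y"
  shows "card (g ` D) = card (g' ` D)"
proof (rule bij_betw_same_card)
  show "bij_betw (\<lambda>c. g' (inv_into D g c)) (g ` D) (g' ` D)"
  proof (rule bij_betw_imageI)
    show "inj_on (\<lambda>c. g' (inv_into D g c)) (g ` D)"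
      by (rule inj_onI) (metis assms f_inv_into_f inv_into_into)
    have "g' (inv_into D g (g x)) = g' x" if "x \<in> D" for x
      using that assms by (metis f_inv_into_f imageI inv_into_into)
    then show "(\<lambda>c. g' (inv_into D g c)) ` g ` D = g' ` D"
      by (simp add: image_image)
  qed
qed

text \<open>Here \<open>\<psi>\<close> may identify elements of \<open>D\<close>, as the projection
  of parallel arcs to a factor does; the equivalence in the last hypothesis then says that
  identified elements lie in one class.\<close>

lemma card_quotient_image:
  assumes R: "equiv A R" and R': "equiv B R'" and D: "D \<subseteq> A" and D': "\<psi> ` D \<subseteq> B"
    and "\<And>e f. e \<in> D \<Longrightarrow> f \<in> D \<Longrightarrow> (e, f) \<in> R \<longleftrightarrow> (\<psi> e, \<psi> f) \<in> R'"
  shows "card (D // R) = card ((\<psi> ` D) // R')"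
proof -
  have "card ((\<lambda>e. R `` {e}) ` D) = card ((\<lambda>e. R' `` {\<psi> e}) ` D)"
  proof (rule card_image_eq)
    fix e f assume "e \<in> D" "f \<in> D"
    with assms show "R `` {e} = R `` {f} \<longleftrightarrow> R' `` {\<psi> e} = R' `` {\<psi> f}"
      by (auto simp: eq_equiv_class_iff[OF R] eq_equiv_class_iff[OF R'] image_subset_iff subset_iff)
  qed
  then show ?thesis by (simp add: quotient_def image_image UNION_singleton_eq_range)
qed

text \<open>Five is the largest number of positions that have to be kept at once: the four ends of
  two arcs and one end of an intermediate arc. Uses with fewer positions repeat an entry.\<close>

lemma ex_fresh_index:
  fixes m :: nat
  assumes "m \<ge> 6"
  obtains i where "i < m" "i \<notin> {a, b, c, d, e}"
proof -
  have "card {a, b, c, d, e} \<le> 5"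
    using card_length[of "[a, b, c, d, e]"] by simp
  then have "\<not> {..<m} \<subseteq> {a, b, c, d, e}"
    using card_mono[of "{a, b, c, d, e}" "{..<m}"] assms by auto
  then show ?thesis using that by auto
qed

lemma THE_const_on:
  assumes "\<And>y. y \<in> A \<Longrightarrow> g y = g x" and x: "x \<in> A"
  shows "(THE n. \<forall>y\<in>A. g y = n) = g x"
proof (rule the_equality)
  show "n = g x" if "\<forall>y\<in>A. g y = n" for n using that x by metis
qed (use assms in blast)

section \<open>Factorisation of connected graphs\<close>

text \<open>Without a walk from \<open>u\<close> to \<open>v\<close> the value is unspecified, but
  it still depends only on the predicate \<open>\<lambda>n. (u, v) \<in> E ^^ n\<close>. Agreement
  of walk lengths in two graphs therefore gives equal values even in disconnected graphs.\<close>

definition gdist :: "'a rel \<Rightarrow> 'a \<Rightarrow> 'a \<Rightarrow> nat" where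
  "gdist E u v = (LEAST n. (u, v) \<in> E ^^ n)"

text \<open>The inequality is the Djokovic-Winkler relation. Arcs are ordered pairs, so every edge
  occurs in both orientations; the inequality relates the two.\<close>

definition prod_step :: "'a rel \<Rightarrow> ('a \<times> 'a) rel" where
  "prod_step E = {((x, y), (u, v)). (x, y) \<in> E \<and> (u, v) \<in> E \<and>
    (gdist E x u + gdist E y v \<noteq> gdist E x v + gdist E y u \<or>
     x = u \<and> (\<forall>w. (y, w) \<in> E \<and> (w, v) \<in> E \<longrightarrow> w = x))}"

text \<open>The transitive closure stays inside the set of arcs; its reflexivity there comes from
  \<open>prod_step\<close> itself.\<close>

definition prod_rel :: "'a rel \<Rightarrow> ('a \<times> 'a) rel" where
  "prod_rel E = (prod_step E)\<^sup>+"

lemma prod_rel_iff_relpow: "(e, f) \<in> prod_rel E \<longleftrightarrow> (\<exists>n>0. (e, f) \<in> prod_step E ^^ n)"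
  by (simp add: prod_rel_def trancl_power)

locale conn_graph =
  fixes V :: "'a set" and E :: "'a rel"
  assumes fin: "finite V"
    and sub: "E \<subseteq> V \<times> V"
    and sym: "sym E"
    and irr: "irrefl E"
    and conn: "\<And>u v. u \<in> V \<Longrightarrow> v \<in> V \<Longrightarrow> (u, v) \<in> E\<^sup>*"
begin

lemma symE: "(u, v) \<in> E \<Longrightarrow> (v, u) \<in> E"
  using sym by (rule symD)

lemma irrE: "(u, u) \<notin> E"
  using irr by (simp add: irrefl_def)

lemma finite_arcs: "finite E"
  using sub fin by (meson finite_SigmaI finite_subset)

lemma relpow_sym: "(u, v) \<in> E ^^ n \<Longrightarrow> (v, u) \<in> E ^^ n"
proof (induction n arbitrary: u v)
  case (Suc n)
  then show ?case by (meson relpow_Suc_D2 relpow_Suc_E relpow_Suc_I2 symE)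
qed auto

lemma gdist_sym: "gdist E u v = gdist E v u"
  unfolding gdist_def using relpow_sym by metis

lemma gdist_refl [simp]: "gdist E u u = 0"
  unfolding gdist_def by (rule Least_eq_0) simp

lemma gdist_le: "(u, v) \<in> E ^^ n \<Longrightarrow> gdist E u v \<le> n"
  unfolding gdist_def by (rule Least_le)

lemma relpow_gdist: "u \<in> V \<Longrightarrow> v \<in> V \<Longrightarrow> (u, v) \<in> E ^^ gdist E u v"
  unfolding gdist_def using conn rtrancl_imp_relpow by (metis LeastI)

lemma gdist_eq_0: "u \<in> V \<Longrightarrow> v \<in> V \<Longrightarrow> gdist E u v = 0 \<longleftrightarrow> u = v"
  using relpow_gdist by force

lemma gdist_edge: "(u, v) \<in> E \<Longrightarrow> gdist E u v = 1"
proof -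
  assume e: "(u, v) \<in> E"
  then have "u \<in> V" "v \<in> V" "u \<noteq> v" using sub irrE by auto
  then show ?thesis using gdist_le[of u v 1] gdist_eq_0[of u v] e by simp
qed

lemma prod_step_sub: "prod_step E \<subseteq> E \<times> E"
  by (auto simp: prod_step_def)

lemma prod_stepI:
  "(x, y) \<in> E \<Longrightarrow> (u, v) \<in> E \<Longrightarrow> gdist E x u + gdist E y v \<noteq> gdist E x v + gdist E y u \<Longrightarrow>
    ((x, y), (u, v)) \<in> prod_step E"
  by (simp add: prod_step_def)

text \<open>For an arc compared with itself the two sums of distances are 0 and 2.\<close>

lemma prod_step_refl: "e \<in> E \<Longrightarrow> (e, e) \<in> prod_step E"
  using gdist_edge[of "fst e" "snd e"] by (cases e) (auto intro!: prod_stepI)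

lemma sym_prod_step: "sym (prod_step E)"
  unfolding prod_step_def
  by (rule symI) (auto simp: gdist_sym add.commute intro: symE)

lemma equiv_prod_rel: "equiv E (prod_rel E)"
  unfolding prod_rel_def
proof (rule equivI)
  show "(prod_step E)\<^sup>+ \<subseteq> E \<times> E"
    using prod_step_sub by (rule trancl_subset_Sigma)
  show "refl_on E ((prod_step E)\<^sup>+)"
    using prod_step_refl by (intro refl_onI) auto
  show "sym ((prod_step E)\<^sup>+)"
    using sym_prod_step by (rule sym_trancl)
qed (rule trans_trancl)

lemma prod_rel_step: "(e, f) \<in> prod_step E \<Longrightarrow> (e, f) \<in> prod_rel E"
  by (auto simp: prod_rel_def)

abbreviation Classes :: "'a rel set" where
  "Classes \<equiv> E // prod_rel E"

lemma finite_Classes: "finite Classes"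
  using finite_arcs equiv_type[OF equiv_prod_rel] by (rule finite_quotient)

lemma class_sub: "c \<in> Classes \<Longrightarrow> c \<subseteq> E"
  using equiv_prod_rel by (rule in_quotient_imp_subset)

lemma class_nonempty: "c \<in> Classes \<Longrightarrow> c \<noteq> {}"
  using equiv_prod_rel by (rule in_quotient_imp_non_empty)

lemma class_step: "c \<in> Classes \<Longrightarrow> (e, f) \<in> prod_step E \<Longrightarrow> e \<in> c \<longleftrightarrow> f \<in> c"
  using equiv_prod_rel prod_rel_step sym_prod_step
  by (meson in_quotient_imp_closed symD)

lemma class_disjoint: "c \<in> Classes \<Longrightarrow> d \<in> Classes \<Longrightarrow> c \<noteq> d \<Longrightarrow> c \<subseteq> E - d"
  using quotient_disj[OF equiv_prod_rel, of c d] class_sub by blast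

lemma Union_Classes: "\<Union>Classes = E"
  using equiv_prod_rel by (rule Union_quotient)

lemma class_sym:
  assumes c: "c \<in> Classes" and e: "(x, y) \<in> c" shows "(y, x) \<in> c"
proof -
  have "(x, y) \<in> E" using c e class_sub by blast
  then have "((x, y), (y, x)) \<in> prod_step E"
    using symE gdist_edge by (intro prod_stepI) auto
  then show ?thesis using class_step[OF c] e by blast
qed

text \<open>
  Along a walk from \<open>u\<close> to \<open>v\<close> the quantity \<open>d(t, u) - d(t, y)\<close> changes, and where it changes the
  edge of the walk is related to \<open>(u, y)\<close>.
\<close>
lemma walk_meets_class:
  assumes uy: "(u, y) \<in> E" and d: "gdist E v u = gdist E v y + 1"
    and D: "D \<subseteq> E" and walk: "(u, v) \<in> D\<^sup>*"
  shows "\<exists>f\<in>D. (f, (u, y)) \<in> prod_step E"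
proof (rule ccontr)
  assume no: "\<not> ?thesis"
  let ?g = "\<lambda>t. int (gdist E t u) - int (gdist E t y)"
  have "?g t = ?g u" if "(u, t) \<in> D\<^sup>*" for t
    using that
  proof (induction rule: rtrancl_induct)
    case (step s t)
    have "((s, t), (u, y)) \<notin> prod_step E" using no step by blast
    then have "gdist E s u + gdist E t y = gdist E s y + gdist E t u"
      using step(2) D uy by (auto simp: prod_step_def)
    then show ?case using step.IH by linarith
  qed simp
  \<comment> \<open>The difference is -1 at \<open>u\<close> and +1 at \<open>v\<close>.\<close>
  from this[OF walk] show False using d gdist_edge[OF uy] by simp
qed

text \<open>If \<open>u \<noteq> v\<close>, let \<open>(u, y)\<close> be the first arc of a shortest
  walk to \<open>v\<close>. As \<open>y\<close> is nearer to \<open>v\<close> than \<open>u\<close>,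
  every walk from \<open>u\<close> to \<open>v\<close> contains an arc related to
  \<open>(u, y)\<close>, so none avoids the class of that arc. This will make the coordinate map
  into the product injective.\<close>

lemma walk_avoiding_all_classes:
  assumes u: "u \<in> V" and v: "v \<in> V" and all: "\<And>c. c \<in> Classes \<Longrightarrow> (u, v) \<in> (E - c)\<^sup>*"
  shows "u = v"
proof (rule ccontr)
  assume ne: "u \<noteq> v"
  then obtain n where n: "gdist E u v = Suc n"
    using gdist_eq_0[OF u v] by (cases "gdist E u v") auto
  then obtain y where y: "(u, y) \<in> E" "(y, v) \<in> E ^^ n"
    using relpow_gdist[OF u v] by (metis relpow_Suc_E2)
  have "y \<in> V" using y sub by auto
  have "gdist E y v = n"
  proof (rule antisym[OF gdist_le[OF y(2)]])
    have "(u, v) \<in> E ^^ Suc (gdist E y v)"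
      using y(1) relpow_gdist[OF \<open>y \<in> V\<close> v] by (rule relpow_Suc_I2)
    from gdist_le[OF this] n show "n \<le> gdist E y v" by simp
  qed
  then have d: "gdist E v u = gdist E v y + 1" using n gdist_sym by (metis Suc_eq_plus1)
  define c where "c = prod_rel E `` {(u, y)}"
  have c: "c \<in> Classes" "(u, y) \<in> c"
    using quotientI[OF y(1)] equiv_class_self[OF equiv_prod_rel y(1)] by (auto simp: c_def)
  obtain f where "f \<in> E - c" "(f, (u, y)) \<in> prod_step E"
    using walk_meets_class[OF y(1) d _ all[OF c(1)]] by blast
  then show False using class_step[OF c(1)] c(2) by blast
qed

text \<open>The same argument with \<open>y = v\<close>. It keeps the factors free of loops.\<close>

lemma class_edge_ends:
  assumes c: "c \<in> Classes" and uv: "(u, v) \<in> c" shows "(u, v) \<notin> (E - c)\<^sup>*"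
proof
  assume walk: "(u, v) \<in> (E - c)\<^sup>*"
  have e: "(u, v) \<in> E" using c uv class_sub by blast
  have "gdist E v u = gdist E v v + 1" using gdist_edge e symE by simp
  then obtain f where "f \<in> E - c" "(f, (u, v)) \<in> prod_step E"
    using walk_meets_class[OF e _ _ walk] by blast
  then show False using class_step[OF c] uv by blast
qed

text \<open>Since \<open>(x, y)\<close> and \<open>(x, z)\<close> are unrelated, the distance
  condition forces \<open>y\<close> and \<open>z\<close> to be at distance 2, and the condition on
  common neighbours supplies one, \<open>w\<close>, other than \<open>x\<close>. Opposite sides of
  this square are related: one sum of distances is \<open>1 + 1\<close>, the other at least
  \<open>1 + 2\<close>.\<close>

lemma square:
  assumes c: "c \<in> Classes" and xy: "(x, y) \<in> c" and xz: "(x, z) \<in> E - c"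
  obtains w where "(z, w) \<in> c" "(y, w) \<in> E - c"
proof -
  have E: "(x, y) \<in> E" "(x, z) \<in> E" using xz xy c class_sub by blast+
  then have V: "x \<in> V" "y \<in> V" "z \<in> V" using sub by auto
  have ns: "((x, y), (x, z)) \<notin> prod_step E" using class_step[OF c] xy xz by blast
  have th: "gdist E y z = 2"
  proof (rule ccontr)
    assume "gdist E y z \<noteq> 2"
    then have "((x, y), (x, z)) \<in> prod_step E"
      using E gdist_edge[OF symE[OF E(1)]] gdist_edge[OF E(2)] by (intro prod_stepI) simp_all
    then show False using ns by blast
  qed
  have "(y, z) \<notin> E" using th gdist_edge[of y z] by auto
  obtain w where w: "(y, w) \<in> E" "(w, z) \<in> E" "w \<noteq> x"
    using ns E by (auto simp: prod_step_def)
  then have "w \<in> V" using sub by auto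
  then have xw: "gdist E x w \<ge> 1" using w V gdist_eq_0[of x w] by (auto simp: Suc_le_eq)
  have zw: "(z, w) \<in> E" using w symE by blast
  have "((x, y), (z, w)) \<in> prod_step E"
    using E w zw xw th by (auto simp: prod_step_def gdist_edge)
  then have 1: "(z, w) \<in> c" using class_step[OF c] xy by blast
  have "((x, z), (y, w)) \<in> prod_step E"
    using E w zw xw th gdist_sym[of z y] by (auto simp: prod_step_def gdist_edge)
  then have "(y, w) \<notin> c" using class_step[OF c] xz by blast
  with 1 w that show ?thesis by blast
qed

text \<open>The arc is carried along the walk by one square per edge, its second end tracing a
  parallel walk outside \<open>c\<close>.\<close>

lemma transport:
  assumes c: "c \<in> Classes" and xy: "(x, y) \<in> c" and xz: "(x, z) \<in> (E - c)\<^sup>*"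
  shows "\<exists>w. (z, w) \<in> c \<and> (y, w) \<in> (E - c)\<^sup>*"
  using xz
proof (induction rule: rtrancl_induct)
  case base
  then show ?case using xy by blast
next
  case (step z z')
  then obtain w where w: "(z, w) \<in> c" "(y, w) \<in> (E - c)\<^sup>*" by blast
  obtain w' where "(z', w') \<in> c" "(w, w') \<in> E - c"
    using square[OF c w(1) step(2)] .
  with w show ?case by (meson rtrancl.rtrancl_into_rtrancl)
qed

text \<open>Arcs of \<open>c\<close> can be moved to the front: when one is appended at
  \<open>v\<close>, it is transported back along the reversed walk from \<open>v\<close> to
  \<open>w\<close>.\<close>

lemma sort_walk:
  assumes c: "c \<in> Classes" and uv: "(u, v) \<in> E\<^sup>*"
  shows "\<exists>w. (u, w) \<in> c\<^sup>* \<and> (w, v) \<in> (E - c)\<^sup>*"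
  using uv
proof (induction rule: rtrancl_induct)
  case (step v v')
  then obtain w where w: "(u, w) \<in> c\<^sup>*" "(w, v) \<in> (E - c)\<^sup>*" by blast
  show ?case
  proof (cases "(v, v') \<in> c")
    case True
    have "sym (E - c)" using symE class_sym[OF c] by (auto simp: sym_def)
    then have "(v, w) \<in> (E - c)\<^sup>*" using w(2) by (metis sym_rtrancl symD)
    then obtain w' where "(w, w') \<in> c" "(v', w') \<in> (E - c)\<^sup>*"
      using transport[OF c True] by blast
    moreover from this(2) have "(w', v') \<in> (E - c)\<^sup>*"
      using \<open>sym (E - c)\<close> by (metis sym_rtrancl symD)
    ultimately show ?thesis using w(1) by (meson rtrancl.rtrancl_into_rtrancl)
  next
    case False
    then have "(v, v') \<in> E - c" using step by blast
    then show ?thesis using w by (meson rtrancl.rtrancl_into_rtrancl)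
  qed
qed blast

lemma sym_compl: "c \<in> Classes \<Longrightarrow> sym ((E - c)\<^sup>*)"
  using symE class_sym by (intro sym_rtrancl) (auto simp: sym_def)

lemma class_walk_sub:
  "c \<in> Classes \<Longrightarrow> d \<in> Classes \<Longrightarrow> c \<noteq> d \<Longrightarrow> c\<^sup>* \<subseteq> (E - d)\<^sup>*"
  by (intro rtrancl_mono class_disjoint)

lemma walk_in_V:
  assumes "u \<in> V" "D \<subseteq> E" "(u, v) \<in> D\<^sup>*"
  shows "v \<in> V"
  using assms(3) by (cases rule: rtranclE) (use assms sub in auto)

text \<open>This is a Chinese remainder argument, and it will make the coordinate map surjective. To
  adjust the coordinate of a further class \<open>d\<close>, one moves along arcs of
  \<open>d\<close> only; such a walk avoids every other class, so the coordinates already reached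
  are kept.\<close>

lemma common_representative:
  assumes F: "F \<subseteq> Classes" and t: "\<And>c. c \<in> F \<Longrightarrow> t c \<in> V" and "V \<noteq> {}"
  shows "\<exists>v\<in>V. \<forall>c\<in>F. (v, t c) \<in> (E - c)\<^sup>*"
proof -
  have "finite F" using F finite_Classes finite_subset by blast
  then show ?thesis using F t
  proof (induction rule: finite_induct)
    case empty
    then show ?case using \<open>V \<noteq> {}\<close> by blast
  next
    case (insert d F)
    then obtain v where v: "v \<in> V" "\<And>c. c \<in> F \<Longrightarrow> (v, t c) \<in> (E - c)\<^sup>*" by auto
    have d: "d \<in> Classes" "t d \<in> V" using insert.prems by auto
    obtain w where w: "(v, w) \<in> d\<^sup>*" "(w, t d) \<in> (E - d)\<^sup>*"
      using sort_walk[OF d(1) conn[OF v(1) d(2)]] by blast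
    have "(w, t c) \<in> (E - c)\<^sup>*" if c: "c \<in> F" for c
    proof -
      have "c \<in> Classes" "c \<noteq> d" using c insert by auto
      then have "(w, v) \<in> (E - c)\<^sup>*"
        using w(1) class_walk_sub[OF d(1), of c] sym_compl by (metis subsetD symD)
      then show ?thesis using v(2)[OF c] by simp
    qed
    moreover have "w \<in> V" using walk_in_V[OF v(1) class_sub[OF d(1)] w(1)] .
    ultimately show ?case using w(2) by blast
  qed
qed

end

section \<open>Library graphs, connectedness and isomorphism in terms of vertex and arc sets\<close>

lemma pair_graph_iff:
  "pair_graph X \<longleftrightarrow> finite (pverts X) \<and> parcs X \<subseteq> pverts X \<times> pverts X \<and> sym (parcs X) \<and> irrefl (parcs X)"
    (is "_ \<longleftrightarrow> ?R")
proof
  assume X: "pair_graph X"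
  then have "pair_fin_digraph X" "pair_loopfree_digraph X" "pair_sym_digraph X"
    unfolding pair_graph_def pair_digraph_def pair_pseudo_graph_def by simp_all
  moreover from this have "pair_wf_digraph X" by (simp add: pair_fin_digraph_def)
  ultimately show ?R
    unfolding irrefl_def
    using pair_fin_digraph.pair_finite_verts[of X] pair_loopfree_digraph.pair_no_loops[of X "(a, a)" for a]
      pair_sym_digraph.pair_sym_arcs[of X] pair_wf_digraph.in_arcsD1[of X] pair_wf_digraph.in_arcsD2[of X]
    by (auto simp: symmetric_def)
next
  assume R: ?R
  then have "finite (parcs X)" by (meson finite_SigmaI finite_subset)
  moreover have wf: "pair_wf_digraph X" using R by (auto simp: pair_wf_digraph_def)
  ultimately have "pair_fin_digraph X"
    using R by (simp add: pair_fin_digraph_def pair_fin_digraph_axioms_def)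
  moreover have "pair_sym_digraph X"
    using R wf by (simp add: pair_sym_digraph_def pair_sym_digraph_axioms_def symmetric_def)
  moreover have "pair_loopfree_digraph X"
    using R wf by (auto simp: pair_loopfree_digraph_def pair_loopfree_digraph_axioms_def irrefl_def)
  ultimately show "pair_graph X"
    by (simp add: pair_graph_def pair_digraph_def pair_pseudo_graph_def)
qed

lemma connected_iff:
  assumes "pair_graph X"
  shows "Digraph_Component.connected (with_proj X) \<longleftrightarrow>
    pverts X \<noteq> {} \<and> (\<forall>u\<in>pverts X. \<forall>v\<in>pverts X. (u, v) \<in> (parcs X)\<^sup>*)"
proof -
  have X: "parcs X \<subseteq> pverts X \<times> pverts X" "sym (parcs X)"
    using assms by (simp_all add: pair_graph_iff)
  have "parcs (mk_symmetric X) = parcs X"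
    using symD[OF X(2)] by (auto simp: parcs_mk_symmetric)
  moreover have "(u, v) \<in> rtrancl_on (pverts X) (parcs X) \<longleftrightarrow> u \<in> pverts X \<and> (u, v) \<in> (parcs X)\<^sup>*" for u v
  proof
    assume u: "u \<in> pverts X \<and> (u, v) \<in> (parcs X)\<^sup>*"
    from u have "(u, v) \<in> (parcs X)\<^sup>*" ..
    then show "(u, v) \<in> rtrancl_on (pverts X) (parcs X)"
    proof (induction rule: rtrancl_induct)
      case (step y z)
      then show ?case using X(1) by (blast intro: rtrancl_on_into_rtrancl_on)
    qed (use u in simp)
  qed (auto dest: rtrancl_on_rtranclI in_rtrancl_on_in_F)
  ultimately show ?thesis
    unfolding Digraph_Component.connected_def strongly_connected_def reachable_def by auto
qed

lemma pair_graph_connected_iff: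
  "pair_graph X \<and> Digraph_Component.connected (with_proj X) \<longleftrightarrow>
    pverts X \<noteq> {} \<and> conn_graph (pverts X) (parcs X)"
  using connected_iff[of X] pair_graph_iff[of X] unfolding conn_graph_def by blast

text \<open>\<open>Y\<close> is only asked to have its arcs between its vertices, so the equivalence
  applies to a Cartesian product before that is known to be a graph.\<close>

lemma graph_iso_iff:
  assumes X: "pair_graph X" and Y: "parcs Y \<subseteq> pverts Y \<times> pverts Y"
  shows "graph_iso X Y \<longleftrightarrow> (\<exists>h. bij_betw h (pverts X) (pverts Y) \<and>
    (\<forall>u\<in>pverts X. \<forall>v\<in>pverts X. (u, v) \<in> parcs X \<longleftrightarrow> (h u, h v) \<in> parcs Y))"
    (is "?L \<longleftrightarrow> ?R")
proof
  have arcs: "parcs X \<subseteq> pverts X \<times> pverts X" using X by (simp add: pair_graph_iff)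
  {
    assume ?L
    then obtain f where f: "pre_digraph.digraph_isomorphism (with_proj X) f" and "with_proj Y = app_iso f X"
      unfolding graph_iso_def digraph_iso_def by blast
    then have Y': "pverts Y = iso_verts f ` pverts X" "parcs Y = iso_arcs f ` parcs X"
      "iso_tail f = fst" "iso_head f = snd"
      by (simp_all add: app_iso_def with_proj_def)
    have arc: "iso_arcs f (u, v) = (iso_verts f u, iso_verts f v)" if "(u, v) \<in> parcs X" for u v
      using f that Y'(3,4) unfolding pre_digraph.digraph_isomorphism_def by (auto simp: prod_eq_iff)
    have inj: "inj_on (iso_verts f) (pverts X)"
      using f by (simp add: pre_digraph.digraph_isomorphism_def)
    have "(u, v) \<in> parcs X \<longleftrightarrow> (iso_verts f u, iso_verts f v) \<in> parcs Y"
      if uv: "u \<in> pverts X" "v \<in> pverts X" for u v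
    proof
      assume "(iso_verts f u, iso_verts f v) \<in> parcs Y"
      then obtain a b where "(a, b) \<in> parcs X" "iso_verts f u = iso_verts f a"
        "iso_verts f v = iso_verts f b"
        using arc Y'(2) by force
      moreover have "a \<in> pverts X" "b \<in> pverts X" using calculation(1) arcs by auto
      ultimately show "(u, v) \<in> parcs X" using inj_onD[OF inj] uv by metis
    qed (use arc Y'(2) in force)
    then show ?R using inj Y'(1) by (auto simp: bij_betw_def)
  next
    assume ?R
    then obtain h where h: "bij_betw h (pverts X) (pverts Y)"
      and e: "\<And>u v. u \<in> pverts X \<Longrightarrow> v \<in> pverts X \<Longrightarrow> (u, v) \<in> parcs X \<longleftrightarrow> (h u, h v) \<in> parcs Y"
      by blast
    let ?f = "\<lparr>iso_verts = h, iso_arcs = map_prod h h, iso_head = snd, iso_tail = fst\<rparr>"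
    have inj: "inj_on h (pverts X)" using h by (simp add: bij_betw_def)
    have "inj_on (map_prod h h) (parcs X)"
      using map_prod_inj_on[OF inj inj] arcs by (rule inj_on_subset)
    moreover have "wf_digraph (with_proj X)" using arcs by (auto simp: wf_digraph_def)
    ultimately have "pre_digraph.digraph_isomorphism (with_proj X) ?f"
      using inj unfolding pre_digraph.digraph_isomorphism_def by auto
    moreover have "map_prod h h ` parcs X = parcs Y"
    proof
      show "parcs Y \<subseteq> map_prod h h ` parcs X"
      proof
        fix a assume a: "a \<in> parcs Y"
        then have "a \<in> map_prod h h ` (pverts X \<times> pverts X)"
          using Y h by (auto simp: bij_betw_def map_prod_surj_on)
        then obtain u v where "u \<in> pverts X" "v \<in> pverts X" "a = map_prod h h (u, v)"
          by (rule imageE) (metis mem_Sigma_iff surj_pair)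
        then show "a \<in> map_prod h h ` parcs X" using e a by (metis image_eqI map_prod_simp)
      qed
    qed (use arcs e in auto)
    then have "with_proj Y = app_iso ?f X"
      using h by (simp add: app_iso_def with_proj_def bij_betw_def)
    ultimately show ?L unfolding graph_iso_def digraph_iso_def by blast
  }
qed

lemma pverts_cartesian_product:
  "pverts (cartesian_product Xs) =
    {x. length x = length Xs \<and> (\<forall>i<length Xs. x ! i \<in> pverts (Xs ! i))}"
  by (simp add: cartesian_product_def Let_def)

lemma parcs_cartesian_product:
  "(x, y) \<in> parcs (cartesian_product Xs) \<longleftrightarrow>
    x \<in> pverts (cartesian_product Xs) \<and> y \<in> pverts (cartesian_product Xs) \<and>
    (\<exists>i<length Xs. (x ! i, y ! i) \<in> parcs (Xs ! i) \<and> (\<forall>j<length Xs. j \<noteq> i \<longrightarrow> x ! j = y ! j))"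
  by (auto simp: cartesian_product_def Let_def)

lemma cartesian_product_arcs_sub:
  "parcs (cartesian_product Xs) \<subseteq>
    pverts (cartesian_product Xs) \<times> pverts (cartesian_product Xs)"
  by (auto simp: parcs_cartesian_product)

text \<open>For a connected graph this turns out to be the number of prime factors. It is 0 for the
  one-vertex graph, in agreement with the empty product.\<close>

definition prod_classes :: "'a pair_pre_digraph \<Rightarrow> nat" where
  "prod_classes X = card (parcs X // prod_rel (parcs X))"

section \<open>Realising the classes as factors of the graph\<close>

context conn_graph
begin

text \<open>The components of \<open>E - c\<close> are numbered because the factors have to be
  graphs on natural numbers.\<close>

lemma factor_labelling:
  assumes "c \<in> Classes"
  obtains l :: "'a \<Rightarrow> nat"
  where "\<And>u v. u \<in> V \<Longrightarrow> v \<in> V \<Longrightarrow> l u = l v \<longleftrightarrow> (u, v) \<in> (E - c)\<^sup>*"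
proof -
  let ?K = "\<lambda>u. (E - c)\<^sup>* `` {u}"
  have "equiv UNIV ((E - c)\<^sup>*)"
    using sym_compl[OF assms] by (auto intro!: equivI refl_rtrancl trans_rtrancl)
  then have K: "?K u = ?K v \<longleftrightarrow> (u, v) \<in> (E - c)\<^sup>*" for u v
    by (simp add: eq_equiv_class_iff)
  have "finite (?K ` V)" using fin by simp
  from finite_imp_inj_to_nat_seg[OF this] obtain h :: "'a set \<Rightarrow> nat" where h: "inj_on h (?K ` V)" by auto
  have "h (?K u) = h (?K v) \<longleftrightarrow> (u, v) \<in> (E - c)\<^sup>*" if "u \<in> V" "v \<in> V" for u v
    using inj_on_eq_iff[OF h imageI[OF that(1)] imageI[OF that(2)]] K by metis
  then show ?thesis by (rule that)
qed

text \<open>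
  The factor belonging to a class \<open>c\<close> arises by contracting all walks outside \<open>c\<close>.
\<close>
theorem decomposition:
  assumes "V \<noteq> {}"
  shows "\<exists>Xs :: nat pair_pre_digraph list. length Xs = card Classes \<and>
    (\<forall>Y\<in>set Xs. pair_graph Y \<and> Digraph_Component.connected (with_proj Y) \<and> 2 \<le> card (pverts Y)) \<and>
    graph_iso \<lparr>pverts = V, parcs = E\<rparr> (cartesian_product Xs)"
proof -
  obtain cs where cs: "set cs = Classes" "distinct cs"
    using finite_distinct_list[OF finite_Classes] by blast
  define k where "k = length cs"
  have cl: "cs ! i \<in> Classes" if "i < k" for i using that cs nth_mem by (metis k_def)
  have neq: "cs ! i \<noteq> cs ! j" if "i < k" "j < k" "i \<noteq> j" for i j
    using that cs(2) by (simp add: k_def nth_eq_iff_index_eq)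
  have "\<exists>l :: 'a \<Rightarrow> nat. \<forall>u\<in>V. \<forall>v\<in>V. l u = l v \<longleftrightarrow> (u, v) \<in> (E - c)\<^sup>*" if "c \<in> Classes" for c
    using factor_labelling[OF that] by metis
  then obtain l :: "'a rel \<Rightarrow> 'a \<Rightarrow> nat"
    where l: "\<And>c u v. c \<in> Classes \<Longrightarrow> u \<in> V \<Longrightarrow> v \<in> V \<Longrightarrow> l c u = l c v \<longleftrightarrow> (u, v) \<in> (E - c)\<^sup>*"
    by metis
  define Q where "Q c = \<lparr>pverts = l c ` V, parcs = map_prod (l c) (l c) ` c\<rparr>" for c
  define Xs where "Xs = map Q cs"
  have len: "length Xs = k" by (simp add: Xs_def k_def)
  have nth: "Xs ! i = Q (cs ! i)" if "i < k" for i using that by (simp add: Xs_def k_def)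
  have Vc: "u \<in> V" "v \<in> V" if "c \<in> Classes" "(u, v) \<in> c" for c u v
    using that class_sub sub by blast+
  have loop: "l c u \<noteq> l c v" if "c \<in> Classes" "(u, v) \<in> c" for c u v
    using class_edge_ends[OF that] l[OF that(1)] Vc[OF that] by simp
  have factor: "pair_graph (Q c) \<and> Digraph_Component.connected (with_proj (Q c)) \<and>
      2 \<le> card (pverts (Q c))" if c: "c \<in> Classes" for c
  proof -
    have "(l c u, l c v) \<in> (parcs (Q c))\<^sup>*" if u: "u \<in> V" and v: "(u, v) \<in> E\<^sup>*" for u v
      using v
    proof (induction rule: rtrancl_induct)
      case (step v w)
      have V: "v \<in> V" "w \<in> V" using step(2) sub by auto
      show ?case
      proof (cases "(v, w) \<in> c")
        case True
        then have "(l c v, l c w) \<in> parcs (Q c)" by (force simp: Q_def)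
        with step.IH show ?thesis by simp
      next
        case False
        then have "(v, w) \<in> (E - c)\<^sup>*" using step(2) by blast
        then have "l c v = l c w" using l[OF c] V by simp
        then show ?thesis using step.IH by simp
      qed
    qed simp
    then have walks: "\<forall>a\<in>pverts (Q c). \<forall>b\<in>pverts (Q c). (a, b) \<in> (parcs (Q c))\<^sup>*"
      using conn by (auto simp: Q_def)
    have pg: "pair_graph (Q c)"
      unfolding pair_graph_iff
    proof (intro conjI)
      show "parcs (Q c) \<subseteq> pverts (Q c) \<times> pverts (Q c)" using Vc[OF c] by (auto simp: Q_def)
      show "sym (parcs (Q c))" using class_sym[OF c] by (force simp: Q_def sym_def)
      show "irrefl (parcs (Q c))" using loop[OF c] by (auto simp: Q_def irrefl_def)
    qed (simp add: Q_def fin)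
    obtain u v where uv: "(u, v) \<in> c" using class_nonempty[OF c] by auto
    then have "{l c u, l c v} \<subseteq> pverts (Q c)" using Vc[OF c] by (auto simp: Q_def)
    moreover have "card {l c u, l c v} = 2" using loop[OF c uv] by simp
    moreover have "finite (pverts (Q c))" using fin by (simp add: Q_def)
    ultimately have "2 \<le> card (pverts (Q c))" by (metis card_mono)
    moreover have "Digraph_Component.connected (with_proj (Q c))"
      using walks connected_iff[OF pg] assms by (simp add: Q_def)
    ultimately show ?thesis using pg by simp
  qed
  define h where "h v = map (\<lambda>c. l c v) cs" for v
  have hn: "h v ! i = l (cs ! i) v" if "i < k" for v i using that by (simp add: h_def k_def)
  have eq: "u = v" if uv: "u \<in> V" "v \<in> V" and "\<And>i. i < k \<Longrightarrow> l (cs ! i) u = l (cs ! i) v" for u v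
  proof (rule walk_avoiding_all_classes[OF uv])
    fix c assume c: "c \<in> Classes"
    then obtain i where "i < k" "c = cs ! i" using cs(1) by (metis in_set_conv_nth k_def)
    then have "l c u = l c v" using that by simp
    then show "(u, v) \<in> (E - c)\<^sup>*" using l[OF c uv] by blast
  qed
  have verts: "pverts (cartesian_product Xs) = {x. length x = k \<and> (\<forall>i<k. x ! i \<in> l (cs ! i) ` V)}"
    by (auto simp: pverts_cartesian_product len nth Q_def)
  have hV: "h v \<in> pverts (cartesian_product Xs)" if "v \<in> V" for v
    using that by (auto simp: verts hn) (simp add: h_def k_def)
  have inj: "inj_on h V"
    by (rule inj_onI) (metis eq hn)
  have surj: "x \<in> h ` V" if x: "x \<in> pverts (cartesian_product Xs)" for x
  proof -
    have "\<forall>i. i < k \<longrightarrow> (\<exists>v. v \<in> V \<and> x ! i = l (cs ! i) v)" using x by (auto simp: verts)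
    then obtain s where s: "\<And>i. i < k \<Longrightarrow> s i \<in> V \<and> x ! i = l (cs ! i) (s i)" by metis
    \<comment> \<open>\<open>common_representative\<close> expects one prescribed vertex per class,
      so positions in \<open>cs\<close> are turned back into classes; distinctness makes the
      position unique.\<close>
    define t where "t c = s (THE i. i < k \<and> cs ! i = c)" for c
    have t: "t (cs ! i) = s i" if "i < k" for i
    proof -
      have "(THE j. j < k \<and> cs ! j = cs ! i) = i" using that neq by (intro the_equality) blast+
      then show ?thesis by (simp add: t_def)
    qed
    have "t c \<in> V" if "c \<in> Classes" for c
      using that t s cs(1) by (metis in_set_conv_nth k_def)
    then obtain v where v: "v \<in> V" "\<forall>c\<in>Classes. (v, t c) \<in> (E - c)\<^sup>*"
      using common_representative[OF subset_refl _ assms] by blast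
    have "x = h v"
    proof (rule nth_equalityI)
      fix i assume "i < length x"
      then have i: "i < k" using x by (simp add: verts)
      then have "(v, s i) \<in> (E - cs ! i)\<^sup>*" using v(2) cl t by metis
      then show "x ! i = h v ! i" using l[OF cl[OF i] v(1)] s[OF i] hn[OF i] by metis
    qed (use x in \<open>simp add: verts h_def k_def\<close>)
    then show ?thesis using v by blast
  qed
  have bij: "bij_betw h V (pverts (cartesian_product Xs))"
    using inj surj hV by (auto simp: bij_betw_def)
  have arcs: "(u, v) \<in> E \<longleftrightarrow> (h u, h v) \<in> parcs (cartesian_product Xs)" if uv: "u \<in> V" "v \<in> V" for u v
  proof
    assume e: "(u, v) \<in> E"
    then obtain i where i: "i < k" "(u, v) \<in> cs ! i"
      using Union_Classes cs(1) by (metis UnionE in_set_conv_nth k_def)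
    have "l (cs ! j) u = l (cs ! j) v" if j: "j < k" "j \<noteq> i" for j
    proof -
      have "(u, v) \<in> E - cs ! j" using class_disjoint[OF cl cl neq] i j by blast
      then show ?thesis using l[OF cl[OF j(1)] uv] by blast
    qed
    moreover have "(h u ! i, h v ! i) \<in> parcs (Xs ! i)"
      using i by (force simp: hn nth Q_def)
    ultimately show "(h u, h v) \<in> parcs (cartesian_product Xs)"
      using i hV uv by (auto simp: parcs_cartesian_product len hn)
  next
    assume "(h u, h v) \<in> parcs (cartesian_product Xs)"
    then obtain i where i: "i < k" "(h u ! i, h v ! i) \<in> parcs (Xs ! i)"
      and same: "\<And>j. j < k \<Longrightarrow> j \<noteq> i \<Longrightarrow> l (cs ! j) u = l (cs ! j) v"
      by (auto simp: parcs_cartesian_product len hn)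
    define c where "c = cs ! i"
    have c: "c \<in> Classes" using cl i by (simp add: c_def)
    obtain a b where ab: "(a, b) \<in> c" "l c u = l c a" "l c v = l c b"
      using i by (auto simp: hn nth Q_def c_def)
    have abV: "a \<in> V" "b \<in> V" using Vc[OF c ab(1)] .
    \<comment> \<open>The arc of the factor comes from an arc \<open>(a, b)\<close> of
      \<open>c\<close> that may lie elsewhere in the graph. Carried over to \<open>u\<close> it ends
      in a vertex \<open>w\<close>, which then has all the coordinates of \<open>v\<close>.\<close>
    have "(a, u) \<in> (E - c)\<^sup>*" using l[OF c abV(1) uv(1)] ab by simp
    then obtain w where w: "(u, w) \<in> c" "(b, w) \<in> (E - c)\<^sup>*"
      using transport[OF c ab(1)] by blast
    have wV: "w \<in> V" using Vc[OF c w(1)] by simp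
    have "w = v"
    proof (rule eq[OF wV uv(2)])
      fix j assume j: "j < k"
      show "l (cs ! j) w = l (cs ! j) v"
      proof (cases "j = i")
        case True
        then show ?thesis using l[OF c abV(2) wV] w ab by (simp add: c_def)
      next
        case False
        have "(u, w) \<in> E - cs ! j"
          using class_disjoint[OF c cl[OF j]] neq[OF i(1) j] False w(1) c_def by blast
        then have "l (cs ! j) u = l (cs ! j) w" using l[OF cl[OF j] uv(1) wV] by blast
        then show ?thesis using same[OF j False] by simp
      qed
    qed
    then show "(u, v) \<in> E" using w class_sub[OF c] by blast
  qed
  have "pair_graph \<lparr>pverts = V, parcs = E\<rparr>" using fin sub sym irr by (simp add: pair_graph_iff)
  then have "graph_iso \<lparr>pverts = V, parcs = E\<rparr> (cartesian_product Xs)"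
    using bij arcs by (auto simp: graph_iso_iff[OF _ cartesian_product_arcs_sub])
  moreover have "length Xs = card Classes"
    using cs distinct_card[of cs] by (simp add: Xs_def)
  moreover have "\<forall>Y\<in>set Xs. pair_graph Y \<and> Digraph_Component.connected (with_proj Y) \<and> 2 \<le> card (pverts Y)"
    using factor cs(1) by (auto simp: Xs_def)
  ultimately show ?thesis by blast
qed

end

section \<open>Classes of a Cartesian product\<close>

text \<open>As \<open>\<psi>\<close> may identify elements, a path in \<open>S'\<close> is lifted
  with an arbitrary preimage at each stage, and \<open>bwd\<close> covers every choice. A single
  step on one side may correspond to several on the other, hence the closures in \<open>fwd\<close>
  and \<open>bwd\<close>.\<close>

lemma trancl_image_iff:
  assumes closed: "\<And>e f. (e, f) \<in> S \<Longrightarrow> e \<in> D \<Longrightarrow> f \<in> D"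
    and sub': "S' \<subseteq> \<psi> ` D \<times> \<psi> ` D"
    and fwd: "\<And>e f. e \<in> D \<Longrightarrow> f \<in> D \<Longrightarrow> (e, f) \<in> S \<Longrightarrow> (\<psi> e, \<psi> f) \<in> S'\<^sup>+"
    and bwd: "\<And>e f. e \<in> D \<Longrightarrow> f \<in> D \<Longrightarrow> (\<psi> e, \<psi> f) \<in> S' \<Longrightarrow> (e, f) \<in> S\<^sup>+"
    and e: "e \<in> D" and f: "f \<in> D"
  shows "(e, f) \<in> S\<^sup>+ \<longleftrightarrow> (\<psi> e, \<psi> f) \<in> S'\<^sup>+"
proof
  assume "(e, f) \<in> S\<^sup>+"
  then have "f \<in> D \<and> (\<psi> e, \<psi> f) \<in> S'\<^sup>+"
    by (induction rule: trancl_induct) (use closed fwd e in \<open>blast intro: trancl_trans\<close>)+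
  then show "(\<psi> e, \<psi> f) \<in> S'\<^sup>+" ..
next
  have "\<forall>f\<in>D. \<psi> f = q \<longrightarrow> (e, f) \<in> S\<^sup>+" if "(\<psi> e, q) \<in> S'\<^sup>+" for q
    using that
  proof (induction rule: trancl_induct)
    case (base q)
    then show ?case using bwd e by blast
  next
    case (step p q)
    then obtain g where "g \<in> D" "\<psi> g = p" using sub' by blast
    have "(e, f) \<in> S\<^sup>+" if "f \<in> D" "\<psi> f = q" for f
    proof -
      have "(e, g) \<in> S\<^sup>+" using step.IH \<open>g \<in> D\<close> \<open>\<psi> g = p\<close> by blast
      moreover have "(g, f) \<in> S\<^sup>+" using bwd[OF \<open>g \<in> D\<close> that(1)] that(2) step(2) \<open>\<psi> g = p\<close> by simp
      ultimately show ?thesis by (rule trancl_trans)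
    qed
    then show ?case by blast
  qed
  then show "(\<psi> e, \<psi> f) \<in> S'\<^sup>+ \<Longrightarrow> (e, f) \<in> S\<^sup>+" using f by blast
qed

section \<open>Invariance of the class count under isomorphism\<close>

lemma (in conn_graph) isomorphic_image:
  assumes bij: "bij_betw h V V'"
    and sub': "E' \<subseteq> V' \<times> V'"
    and arcs: "\<And>u v. u \<in> V \<Longrightarrow> v \<in> V \<Longrightarrow> (u, v) \<in> E \<longleftrightarrow> (h u, h v) \<in> E'"
  shows "conn_graph V' E'" and "card (E // prod_rel E) = card (E' // prod_rel E')"
proof -
  have V': "V' = h ` V" and inj: "inj_on h V" using bij by (auto simp: bij_betw_def)
  have E': "E' = map_prod h h ` E"
  proof
    show "E' \<subseteq> map_prod h h ` E"
      using sub' arcs unfolding V' by force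
  qed (use arcs sub in auto)
  have relpow: "(u, v) \<in> E ^^ n \<longleftrightarrow> (h u, h v) \<in> E' ^^ n" if "u \<in> V" "v \<in> V" for u v n
    using that(2)
  proof (induction n arbitrary: v)
    case 0
    then show ?case using inj that(1) by (auto dest: inj_onD)
  next
    case (Suc n)
    have "(h u, h v) \<in> E' ^^ Suc n \<longleftrightarrow> (\<exists>w\<in>V. (h u, h w) \<in> E' ^^ n \<and> (h w, h v) \<in> E')"
      using sub' unfolding V' by auto
    also have "\<dots> \<longleftrightarrow> (\<exists>w\<in>V. (u, w) \<in> E ^^ n \<and> (w, v) \<in> E)"
      using Suc arcs by blast
    also have "\<dots> \<longleftrightarrow> (u, v) \<in> E ^^ Suc n" using sub by auto
    finally show ?case by simp
  qed
  show "conn_graph V' E'"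
  proof
    show "sym E'" unfolding E' using symE by (auto simp: sym_def)
    show "irrefl E'"
      unfolding irrefl_def
    proof
      fix a show "(a, a) \<notin> E'"
      proof
        assume "(a, a) \<in> E'"
        moreover from this obtain u where "u \<in> V" "a = h u" using sub' unfolding V' by blast
        ultimately show False using arcs irrE by blast
      qed
    qed
    fix a b assume "a \<in> V'" "b \<in> V'"
    then obtain u v where uv: "u \<in> V" "v \<in> V" and ab: "a = h u" "b = h v" unfolding V' by blast
    have "(h u, h v) \<in> E' ^^ gdist E u v" using relpow[OF uv] relpow_gdist[OF uv] by blast
    then show "(a, b) \<in> E'\<^sup>*" unfolding ab by (rule relpow_imp_rtrancl)
  qed (use fin V' sub' in auto)
  then interpret Y: conn_graph V' E' .
  have dist: "gdist E' (h u) (h v) = gdist E u v" if "u \<in> V" "v \<in> V" for u v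
    unfolding gdist_def using relpow[OF that] by simp
  have step: "(e, f) \<in> prod_step E \<longleftrightarrow> (map_prod h h e, map_prod h h f) \<in> prod_step E'"
    if e: "e \<in> E" and f: "f \<in> E" for e f
  proof -
    obtain x y u v where ef: "e = (x, y)" "f = (u, v)" by (metis surj_pair)
    have V: "x \<in> V" "y \<in> V" "u \<in> V" "v \<in> V" using e f ef sub by auto
    have "(\<forall>w'. (h y, w') \<in> E' \<and> (w', h v) \<in> E' \<longrightarrow> w' = h x) \<longleftrightarrow>
      (\<forall>w\<in>V. (h y, h w) \<in> E' \<and> (h w, h v) \<in> E' \<longrightarrow> h w = h x)"
      using sub' unfolding V' by blast
    also have "\<dots> \<longleftrightarrow> (\<forall>w. (y, w) \<in> E \<and> (w, v) \<in> E \<longrightarrow> w = x)"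
    proof -
      have "h w = h x \<longleftrightarrow> w = x" if "w \<in> V" for w using inj_on_eq_iff[OF inj that V(1)] .
      moreover have "w \<in> V" if "(y, w) \<in> E" for w using that sub by blast
      moreover have "(y, w) \<in> E \<longleftrightarrow> (h y, h w) \<in> E'" "(w, v) \<in> E \<longleftrightarrow> (h w, h v) \<in> E'"
        if "w \<in> V" for w using arcs that V by auto
      ultimately show ?thesis by (metis (no_types, lifting))
    qed
    finally have tau: "(\<forall>w'. (h y, w') \<in> E' \<and> (w', h v) \<in> E' \<longrightarrow> w' = h x) \<longleftrightarrow>
      (\<forall>w. (y, w) \<in> E \<and> (w, v) \<in> E \<longrightarrow> w = x)" .
    have "h x = h u \<longleftrightarrow> x = u" using V inj by (auto dest: inj_onD)
    then show ?thesis
      using e f tau V arcs unfolding ef by (simp add: prod_step_def dist)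
  qed
  have "card (E // prod_rel E) = card ((map_prod h h ` E) // prod_rel E')"
  proof (rule card_quotient_image[OF equiv_prod_rel Y.equiv_prod_rel])
    fix e f assume "e \<in> E" "f \<in> E"
    then show "(e, f) \<in> prod_rel E \<longleftrightarrow> (map_prod h h e, map_prod h h f) \<in> prod_rel E'"
      unfolding prod_rel_def
      using step prod_step_sub Y.prod_step_sub
      by (intro trancl_image_iff[where D = E]) (auto simp: E')
  qed (use E' in auto)
  then show "card (E // prod_rel E) = card (E' // prod_rel E')" using E' by simp
qed

section \<open>Distances and related arcs in a Cartesian product\<close>

locale product_of_conn_graphs =
  fixes Xs :: "'a pair_pre_digraph list"
  assumes factor: "i < length Xs \<Longrightarrow> conn_graph (pverts (Xs ! i)) (parcs (Xs ! i))"
begin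

abbreviation "k \<equiv> length Xs"
abbreviation "V i \<equiv> pverts (Xs ! i)"
abbreviation "E i \<equiv> parcs (Xs ! i)"
abbreviation "PV \<equiv> pverts (cartesian_product Xs)"
abbreviation "PE \<equiv> parcs (cartesian_product Xs)"

lemma PV_iff: "x \<in> PV \<longleftrightarrow> length x = k \<and> (\<forall>i<k. x ! i \<in> V i)"
  by (simp add: pverts_cartesian_product)

lemma PV_update: "x \<in> PV \<Longrightarrow> i < k \<Longrightarrow> a \<in> V i \<Longrightarrow> x[i := a] \<in> PV"
  by (auto simp: PV_iff nth_list_update)

lemma PV_eqI: "x \<in> PV \<Longrightarrow> y \<in> PV \<Longrightarrow> (\<And>i. i < k \<Longrightarrow> x ! i = y ! i) \<Longrightarrow> x = y"
  by (auto simp: PV_iff intro: nth_equalityI)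

lemma E_verts: "i < k \<Longrightarrow> (a, b) \<in> E i \<Longrightarrow> a \<in> V i \<and> b \<in> V i"
  using conn_graph.sub[OF factor] by blast

text \<open>The arcs moving coordinate \<open>i\<close>. Each class of the product will be confined
  to one such direction.\<close>

definition dir :: "nat \<Rightarrow> ('a list \<times> 'a list) set" where
  "dir i = {(x, y). x \<in> PV \<and> y \<in> PV \<and> (x ! i, y ! i) \<in> E i \<and> (\<forall>j<k. j \<noteq> i \<longrightarrow> x ! j = y ! j)}"

lemma PE_dir: "PE = (\<Union>i<k. dir i)"
  by (auto simp: parcs_cartesian_product dir_def)

lemma dir_neq: "i < k \<Longrightarrow> (x, y) \<in> dir i \<Longrightarrow> x ! i \<noteq> y ! i"
  using conn_graph.irrE[OF factor, of i "x ! i"] by (auto simp: dir_def)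

lemma dir_disjoint: "i < k \<Longrightarrow> j < k \<Longrightarrow> i \<noteq> j \<Longrightarrow> dir i \<inter> dir j = {}"
proof (rule ccontr)
  assume ij: "i < k" "j < k" "i \<noteq> j" and "dir i \<inter> dir j \<noteq> {}"
  then obtain x y where "(x, y) \<in> dir i" "(x, y) \<in> dir j" by auto
  then show False using dir_neq[OF ij(1), of x y] ij by (simp add: dir_def)
qed

lemma dir_update: "x \<in> PV \<Longrightarrow> i < k \<Longrightarrow> (x ! i, a) \<in> E i \<Longrightarrow> (x, x[i := a]) \<in> dir i"
  using PV_update E_verts by (auto simp: dir_def PV_iff nth_list_update)

lemma finite_PV: "finite PV"
proof (rule finite_subset)
  show "PV \<subseteq> {x. set x \<subseteq> (\<Union>i<k. V i) \<and> length x = k}"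
  proof
    fix x assume x: "x \<in> PV"
    then have "a \<in> (\<Union>i<k. V i)" if "a \<in> set x" for a
      using that by (metis PV_iff UN_iff in_set_conv_nth lessThan_iff)
    then show "x \<in> {x. set x \<subseteq> (\<Union>i<k. V i) \<and> length x = k}" using x by (auto simp: PV_iff)
  qed
  show "finite {x. set x \<subseteq> (\<Union>i<k. V i) \<and> length x = k}"
    using conn_graph.fin[OF factor] by (intro finite_lists_length_eq) auto
qed

text \<open>A walk in the product is a shuffle of one walk in each factor, and the lengths add up.
  Consequently distances in the product are sums of distances in the factors.\<close>

lemma relpow_product_iff:
  assumes "x \<in> PV" "y \<in> PV"
  shows "(x, y) \<in> PE ^^ n \<longleftrightarrow> (\<exists>ns. (\<forall>i<k. (x ! i, y ! i) \<in> E i ^^ ns i) \<and> n = (\<Sum>i<k. ns i))"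
proof
  show "(x, y) \<in> PE ^^ n \<Longrightarrow> \<exists>ns. (\<forall>i<k. (x ! i, y ! i) \<in> E i ^^ ns i) \<and> n = (\<Sum>i<k. ns i)"
  proof (induction n arbitrary: y)
    case 0
    then show ?case by (intro exI[of _ "\<lambda>_. 0"]) auto
  next
    case (Suc n)
    then obtain z where z: "(x, z) \<in> PE ^^ n" "(z, y) \<in> PE" by auto
    obtain ns where ns: "\<forall>i<k. (x ! i, z ! i) \<in> E i ^^ ns i" "n = (\<Sum>i<k. ns i)"
      using Suc.IH[OF z(1)] by blast
    obtain i where i: "i < k" "(z ! i, y ! i) \<in> E i" "\<forall>j<k. j \<noteq> i \<longrightarrow> z ! j = y ! j"
      using z(2) by (auto simp: parcs_cartesian_product)
    have "(x ! j, y ! j) \<in> E j ^^ (ns j + (if j = i then 1 else 0))" if "j < k" for j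
      using ns(1) i that by (cases "j = i") auto
    moreover have "(\<Sum>j<k. ns j + (if j = i then 1 else 0)) = Suc n"
      using i ns by (simp add: sum.distrib)
    ultimately show ?case by (intro exI[of _ "\<lambda>j. ns j + (if j = i then 1 else 0)"]) simp
  qed
next
  assume "\<exists>ns. (\<forall>i<k. (x ! i, y ! i) \<in> E i ^^ ns i) \<and> n = (\<Sum>i<k. ns i)"
  then obtain ns where "\<forall>i<k. (x ! i, y ! i) \<in> E i ^^ ns i" "n = (\<Sum>i<k. ns i)" by blast
  then show "(x, y) \<in> PE ^^ n"
    using assms(1)
  proof (induction n arbitrary: x ns)
    case 0
    then have "x = y" using assms(2) by (intro PV_eqI) auto
    then show ?case by simp
  next
    case (Suc n)
    \<comment> \<open>A coordinate in which steps remain; taking its next step lowers the total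
      length by one.\<close>
    then obtain i where i: "i < k" "ns i \<noteq> 0"
      by (metis lessThan_iff nat.simps(3) sum.neutral)
    then obtain p where p: "ns i = Suc p" by (cases "ns i") auto
    then obtain w where w: "(x ! i, w) \<in> E i" "(w, y ! i) \<in> E i ^^ p"
      using Suc.prems(1) i by (metis relpow_Suc_D2)
    let ?x = "x[i := w]"
    have e: "(x, ?x) \<in> dir i" using dir_update Suc.prems(3) i w by blast
    have "\<forall>j<k. (?x ! j, y ! j) \<in> E j ^^ (ns(i := p)) j"
      using Suc.prems(1,3) w i by (auto simp: nth_list_update PV_iff)
    moreover have "n = (\<Sum>j<k. (ns(i := p)) j)"
      using Suc.prems(2) p i by (simp add: sum.remove[of _ i] )
    moreover have "?x \<in> PV" using e by (simp add: dir_def)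
    ultimately have "(?x, y) \<in> PE ^^ n" by (rule Suc.IH)
    moreover have "(x, ?x) \<in> PE" using e i PE_dir by blast
    ultimately show ?case by (rule relpow_Suc_I2[rotated])
  qed
qed

lemma relpow_sum_gdist:
  assumes "x \<in> PV" "y \<in> PV"
  shows "(x, y) \<in> PE ^^ (\<Sum>i<k. gdist (E i) (x ! i) (y ! i))"
  unfolding relpow_product_iff[OF assms]
proof (intro exI conjI allI impI)
  show "(x ! i, y ! i) \<in> E i ^^ gdist (E i) (x ! i) (y ! i)" if "i < k" for i
    using that assms by (intro conn_graph.relpow_gdist[OF factor]) (auto simp: PV_iff)
qed simp

lemma sum_gdist_le:
  assumes "x \<in> PV" "y \<in> PV" "(x, y) \<in> PE ^^ n"
  shows "(\<Sum>i<k. gdist (E i) (x ! i) (y ! i)) \<le> n"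
  using assms(3) unfolding relpow_product_iff[OF assms(1,2)]
  using conn_graph.gdist_le[OF factor] by (auto intro: sum_mono)

lemma gdist_product:
  "x \<in> PV \<Longrightarrow> y \<in> PV \<Longrightarrow> gdist PE x y = (\<Sum>i<k. gdist (E i) (x ! i) (y ! i))"
  unfolding gdist_def[of PE]
  by (rule Least_equality) (use relpow_sum_gdist sum_gdist_le in auto)

lemma conn_graph_product: "conn_graph PV PE"
proof
  show "PE \<subseteq> PV \<times> PV" by (rule cartesian_product_arcs_sub)
  have "(y, x) \<in> dir i" if "i < k" "(x, y) \<in> dir i" for i x y
    using conn_graph.symE[OF factor[OF that(1)]] that(2) by (auto simp: dir_def)
  then show "sym PE"
    unfolding PE_dir sym_def by blast
  show "irrefl PE"
    unfolding PE_dir irrefl_def using dir_neq by blast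
  show "(x, y) \<in> PE\<^sup>*" if "x \<in> PV" "y \<in> PV" for x y
    using relpow_sum_gdist[OF that] by (rule relpow_imp_rtrancl)
qed (rule finite_PV)

sublocale P: conn_graph PV PE
  by (rule conn_graph_product)

abbreviation proj :: "nat \<Rightarrow> 'a list \<times> 'a list \<Rightarrow> 'a \<times> 'a" where
  "proj i \<equiv> map_prod (\<lambda>x. x ! i) (\<lambda>x. x ! i)"

lemma dir_PV: "(x, y) \<in> dir i \<Longrightarrow> x \<in> PV \<and> y \<in> PV"
  by (simp add: dir_def)

lemma dir_same: "(x, y) \<in> dir i \<Longrightarrow> j < k \<Longrightarrow> j \<noteq> i \<Longrightarrow> x ! j = y ! j"
  by (simp add: dir_def)

text \<open>For arcs in different directions each coordinate is moved by at most one of them, so it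
  contributes equally to both sums of distances. If the arcs start at the same vertex, the fourth
  corner of the square they span is a second common neighbour of their ends.\<close>

lemma prod_step_dir:
  assumes i: "i < k" and e: "e \<in> dir i" and ef: "(e, f) \<in> prod_step PE"
  shows "f \<in> dir i"
proof (rule ccontr)
  assume nf: "f \<notin> dir i"
  obtain x y u v where xy: "e = (x, y)" and uv: "f = (u, v)" by (metis surj_pair)
  have "f \<in> PE" using ef uv by (auto simp: prod_step_def)
  then obtain j where j: "j < k" "(u, v) \<in> dir j" using uv PE_dir by auto
  have ij: "i \<noteq> j" using nf j uv by auto
  have PV: "x \<in> PV" "y \<in> PV" "u \<in> PV" "v \<in> PV" using dir_PV e j xy by auto
  have "gdist (E l) (x ! l) (u ! l) + gdist (E l) (y ! l) (v ! l) =
      gdist (E l) (x ! l) (v ! l) + gdist (E l) (y ! l) (u ! l)" if "l < k" for l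
    using dir_same[of x y i l] dir_same[OF j(2), of l] e xy ij that by (cases "l = i") auto
  then have "gdist PE x u + gdist PE y v = gdist PE x v + gdist PE y u"
    using PV by (simp add: gdist_product flip: sum.distrib)
  then have xu: "x = u" and tau: "\<And>w. (y, w) \<in> PE \<Longrightarrow> (w, v) \<in> PE \<Longrightarrow> w = x"
    using ef xy uv by (auto simp: prod_step_def)
  define w where "w = y[j := v ! j]"
  have "(x ! j, v ! j) \<in> E j" using j xu by (simp add: dir_def)
  then have "(y, w) \<in> dir j"
    unfolding w_def using e xy ij j PV by (intro dir_update) (auto simp: dir_def)
  then have w: "(y, w) \<in> PE" "w \<in> PV" using j PE_dir dir_PV by auto
  have wi: "w ! i = y ! i" using ij by (simp add: w_def)
  have "(w ! i, v ! i) \<in> E i"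
    using wi e xy dir_same[OF j(2) i ij] xu conn_graph.symE[OF factor[OF i]] by (auto simp: dir_def)
  moreover have "w ! l = v ! l" if "l < k" "l \<noteq> i" for l
  proof (cases "l = j")
    case True
    then show ?thesis using j PV by (simp add: w_def PV_iff)
  next
    case False
    then have "w ! l = y ! l" by (simp add: w_def)
    then show ?thesis using dir_same[of x y i l] dir_same[OF j(2), of l] e xy xu that False by auto
  qed
  ultimately have "(w, v) \<in> PE" using w PV i by (auto simp: parcs_cartesian_product)
  from tau[OF w(1) this] have "w ! i = x ! i" by simp
  then show False using wi dir_neq[OF i, of x y] e xy by auto
qed

text \<open>The other coordinates contribute equally to both sums, so the distance condition holds
  in the product exactly when it holds in the factor. The second alternative demands a common start,
  whereas arcs of the product may share only coordinate \<open>i\<close> of their starts; a parallel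
  arc is then inserted, which is why the second conclusion has a transitive closure.\<close>

lemma prod_step_proj:
  assumes i: "i < k" and e: "e \<in> dir i" and f: "f \<in> dir i"
  shows "(e, f) \<in> prod_step PE \<Longrightarrow> (proj i e, proj i f) \<in> prod_step (E i)"
    and "(proj i e, proj i f) \<in> prod_step (E i) \<Longrightarrow> (e, f) \<in> (prod_step PE)\<^sup>+"
proof -
  interpret F: conn_graph "V i" "E i" by (rule factor[OF i])
  have theta: "gdist PE x u + gdist PE y v \<noteq> gdist PE x v + gdist PE y u \<longleftrightarrow>
      gdist (E i) (x ! i) (u ! i) + gdist (E i) (y ! i) (v ! i) \<noteq>
      gdist (E i) (x ! i) (v ! i) + gdist (E i) (y ! i) (u ! i)"
    if "(x, y) \<in> dir i" "(u, v) \<in> dir i" for x y u v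
  proof -
    have PV: "x \<in> PV" "y \<in> PV" "u \<in> PV" "v \<in> PV" using that dir_PV by auto
    have "(\<Sum>l\<in>{..<k} - {i}. gdist (E l) (x ! l) (u ! l)) = (\<Sum>l\<in>{..<k} - {i}. gdist (E l) (y ! l) (u ! l))"
      "(\<Sum>l\<in>{..<k} - {i}. gdist (E l) (x ! l) (v ! l)) = (\<Sum>l\<in>{..<k} - {i}. gdist (E l) (y ! l) (v ! l))"
      using dir_same[OF that(1)] by (auto intro!: sum.cong)
    then show ?thesis using PV i by (simp add: gdist_product sum.remove[of _ i])
  qed
  have arc: "(x, y) \<in> PE" if "(x, y) \<in> dir i" for x y using that i PE_dir by blast
  obtain x y u v where xy: "e = (x, y)" and uv: "f = (u, v)" by (metis surj_pair)
  have exy: "(x, y) \<in> dir i" and fuv: "(u, v) \<in> dir i" using e f xy uv by auto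
  have PV: "x \<in> PV" "y \<in> PV" "u \<in> PV" "v \<in> PV" using exy fuv dir_PV by auto
  have ei: "(x ! i, y ! i) \<in> E i" "(u ! i, v ! i) \<in> E i" using exy fuv by (auto simp: dir_def)
  have lenx: "length x = k" "length y = k" "length u = k" "length v = k" using PV by (auto simp: PV_iff)
  show "(proj i e, proj i f) \<in> prod_step (E i)" if ef: "(e, f) \<in> prod_step PE"
  proof (cases "gdist PE x u + gdist PE y v \<noteq> gdist PE x v + gdist PE y u")
    case True
    then show ?thesis using theta[OF exy fuv] ei xy uv by (auto simp: prod_step_def)
  next
    case False
    then have xu: "x = u" and tau: "\<And>w. (y, w) \<in> PE \<Longrightarrow> (w, v) \<in> PE \<Longrightarrow> w = x"
      using ef xy uv by (auto simp: prod_step_def)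
    have "a = x ! i" if a: "(y ! i, a) \<in> E i" "(a, v ! i) \<in> E i" for a
    proof -
      let ?w = "x[i := a]"
      have w: "?w \<in> PV" using PV_update PV i a E_verts by blast
      have "(y, ?w) \<in> dir i" using PV w exy a lenx i by (auto simp: dir_def nth_list_update)
      moreover have "(?w, v) \<in> dir i" using PV w fuv xu a lenx i by (auto simp: dir_def nth_list_update)
      ultimately have "?w = x" using tau arc by blast
      then show ?thesis using lenx i by (metis nth_list_update_eq)
    qed
    then show ?thesis using ei xu xy uv by (auto simp: prod_step_def)
  qed
  show "(e, f) \<in> (prod_step PE)\<^sup>+" if ef: "(proj i e, proj i f) \<in> prod_step (E i)"
  proof (cases "gdist (E i) (x ! i) (u ! i) + gdist (E i) (y ! i) (v ! i) \<noteq>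
      gdist (E i) (x ! i) (v ! i) + gdist (E i) (y ! i) (u ! i)")
    case True
    then have "(e, f) \<in> prod_step PE"
      using theta[OF exy fuv] arc exy fuv xy uv by (auto simp: prod_step_def)
    then show ?thesis by simp
  next
    case False
    then have xu: "x ! i = u ! i" and tau: "\<And>a. (y ! i, a) \<in> E i \<Longrightarrow> (a, v ! i) \<in> E i \<Longrightarrow> a = x ! i"
      using ef xy uv by (auto simp: prod_step_def)
    text \<open>Shift \<open>(u, v)\<close> to an arc at \<open>x\<close> with the same projection.\<close>
    define z where "z = x[i := v ! i]"
    have xz: "(x, z) \<in> dir i" unfolding z_def using dir_update PV i ei xu by simp
    have zPV: "z \<in> PV" using xz dir_PV by blast
    have zi: "z ! i = v ! i" using i lenx by (simp add: z_def)
    have "((x, z), (u, v)) \<in> prod_step PE"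
    proof -
      have "gdist (E i) (x ! i) (u ! i) + gdist (E i) (z ! i) (v ! i) \<noteq>
          gdist (E i) (x ! i) (v ! i) + gdist (E i) (z ! i) (u ! i)"
        using xu zi ei F.gdist_edge by simp
      then show ?thesis using theta[OF xz fuv] arc xz fuv by (auto simp: prod_step_def)
    qed
    moreover have "((x, y), (x, z)) \<in> prod_step PE"
    proof (cases "y ! i = v ! i")
      case True
      then have "y = z"
        using PV zPV dir_same[OF exy] dir_same[OF xz] zi by (metis PV_eqI)
      then show ?thesis using P.prod_step_refl arc exy by blast
    next
      case False
      \<comment> \<open>\<open>y\<close> and \<open>z\<close> differ exactly in coordinate
        \<open>i\<close>, so a common neighbour is reached from either by moving that coordinate. It
        thus agrees with \<open>x\<close> elsewhere, and the condition in the factor settles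
        coordinate \<open>i\<close>.\<close>
      have "w = x" if w: "(y, w) \<in> PE" "(w, z) \<in> PE" for w
      proof -
        obtain a where a: "a < k" "(y, w) \<in> dir a" using w PE_dir by auto
        obtain b where b: "b < k" "(w, z) \<in> dir b" using w PE_dir by auto
        have yz: "y ! l = z ! l" if "l < k" "l \<noteq> i" for l
          using dir_same[OF exy that] dir_same[OF xz that] by simp
        have "a = i"
        proof (rule ccontr)
          assume ai: "a \<noteq> i"
          then have "w ! i = y ! i" using dir_same[OF a(2) i] by auto
          then have "b = i" using dir_same[OF b(2) i] False zi by metis
          then have "w ! a = y ! a" using dir_same[OF b(2) a(1)] ai yz[OF a(1)] by auto
          then show False using dir_neq[OF a] by simp
        qed
        moreover have "b = i"
        proof (rule ccontr)
          assume bi: "b \<noteq> i"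
          then have "w ! b = z ! b" using dir_same[OF a(2) b(1)] \<open>a = i\<close> yz[OF b(1)] by simp
          then show False using dir_neq[OF b] by simp
        qed
        ultimately have wi: "(y ! i, w ! i) \<in> E i" "(w ! i, v ! i) \<in> E i"
          using a b zi by (auto simp: dir_def)
        have "w \<in> PV" using a dir_PV by blast
        then show "w = x"
          using PV tau[OF wi] dir_same[OF a(2)] dir_same[OF exy] \<open>a = i\<close> by (metis PV_eqI)
      qed
      then show ?thesis using arc exy xz by (auto simp: prod_step_def)
    qed
    ultimately show ?thesis using xy uv by simp
  qed
qed

text \<open>An arbitrary vertex of the product supplies the remaining coordinates; if some factor
  were empty, every direction would be empty too.\<close>

lemma proj_dir:
  assumes i: "i < k" and "PV \<noteq> {}"
  shows "proj i ` dir i = E i"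
proof
  obtain x where x: "x \<in> PV" using assms by blast
  show "E i \<subseteq> proj i ` dir i"
  proof
    fix e assume e: "e \<in> E i"
    obtain a b where ab: "e = (a, b)" by (cases e)
    have "x[i := a] \<in> PV" using PV_update[OF x i] E_verts[OF i] e ab by blast
    moreover have "x[i := a] ! i = a" using x i by (simp add: PV_iff)
    ultimately have "(x[i := a], x[i := a, i := b]) \<in> dir i" using dir_update i e ab by metis
    moreover have "proj i (x[i := a], x[i := a, i := b]) = e" using x i ab by (simp add: PV_iff)
    ultimately show "e \<in> proj i ` dir i" by (metis imageI)
  qed
qed (auto simp: dir_def)

text \<open>Classes stay within a direction, so they split according to directions. Projecting
  direction \<open>i\<close> to its factor identifies parallel arcs, but matches classes with
  classes.\<close>

lemma card_Classes_product:
  assumes "PV \<noteq> {}"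
  shows "card P.Classes = (\<Sum>i<k. card (E i // prod_rel (E i)))"
proof -
  have closed: "f \<in> dir i" if "(e, f) \<in> prod_rel PE" "e \<in> dir i" "i < k" for e f i
    using that(1) unfolding prod_rel_def
    by (induction rule: trancl_induct) (use prod_step_dir that in auto)
  have sub: "c \<subseteq> dir i" if "c \<in> dir i // prod_rel PE" "i < k" for c i
    using that closed by (auto simp: quotient_def)
  have ne: "c \<noteq> {}" if "c \<in> dir i // prod_rel PE" "i < k" for c i
  proof -
    have "dir i \<subseteq> PE" using PE_dir that by blast
    then have "c \<in> P.Classes" using that by (auto simp: quotient_def)
    then show ?thesis by (rule P.class_nonempty)
  qed
  have "P.Classes = (\<Union>i<k. dir i // prod_rel PE)"
    unfolding quotient_def using PE_dir by blast
  moreover have "card (\<Union>i<k. dir i // prod_rel PE) = (\<Sum>i<k. card (dir i // prod_rel PE))"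
  proof (rule card_UN_disjoint)
    show "\<forall>i\<in>{..<k}. finite (dir i // prod_rel PE)"
      using P.finite_Classes calculation by (auto intro: finite_subset)
    show "\<forall>i\<in>{..<k}. \<forall>j\<in>{..<k}. i \<noteq> j \<longrightarrow> (dir i // prod_rel PE) \<inter> (dir j // prod_rel PE) = {}"
    proof (intro ballI impI, rule ccontr)
      fix i j assume ij: "i \<in> {..<k}" "j \<in> {..<k}" "i \<noteq> j"
        and "(dir i // prod_rel PE) \<inter> (dir j // prod_rel PE) \<noteq> {}"
      then obtain c where "c \<in> dir i // prod_rel PE" "c \<in> dir j // prod_rel PE" by blast
      then have "c \<subseteq> dir i \<inter> dir j" "c \<noteq> {}" using sub ne ij by blast+
      then show False using dir_disjoint ij by blast
    qed
  qed simp
  moreover have "card (dir i // prod_rel PE) = card (E i // prod_rel (E i))" if i: "i < k" for i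
  proof -
    interpret F: conn_graph "V i" "E i" by (rule factor[OF i])
    have "card (dir i // prod_rel PE) = card ((proj i ` dir i) // prod_rel (E i))"
    proof (rule card_quotient_image[OF P.equiv_prod_rel F.equiv_prod_rel])
      show "dir i \<subseteq> PE" using PE_dir i by blast
      fix e f assume ef: "e \<in> dir i" "f \<in> dir i"
      show "(e, f) \<in> prod_rel PE \<longleftrightarrow> (proj i e, proj i f) \<in> prod_rel (E i)"
        unfolding prod_rel_def
      proof (rule trancl_image_iff[where D = "dir i"])
        show "prod_step (E i) \<subseteq> proj i ` dir i \<times> proj i ` dir i"
          unfolding proj_dir[OF i assms] by (rule F.prod_step_sub)
      qed (use prod_step_dir prod_step_proj i ef in blast)+
    qed (simp add: proj_dir[OF i assms])
    then show ?thesis by (simp add: proj_dir[OF i assms])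
  qed
  ultimately show ?thesis by simp
qed

end

section \<open>Primality and prime factorisations in terms of the class count\<close>

lemma connected_imp_conn_graph:
  assumes "pair_graph X" "Digraph_Component.connected (with_proj X)"
  shows "conn_graph (pverts X) (parcs X)" and "pverts X \<noteq> {}"
  using assms pair_graph_connected_iff[of X] by simp_all

lemma conn_graph_imp_connected:
  assumes "conn_graph (pverts X) (parcs X)" and "pverts X \<noteq> {}"
  shows "pair_graph X \<and> Digraph_Component.connected (with_proj X)"
  using assms pair_graph_connected_iff[of X] by simp

lemma product_of_conn_graphsI:
  "\<forall>Y\<in>set Xs. pair_graph Y \<and> Digraph_Component.connected (with_proj Y) \<Longrightarrow> product_of_conn_graphs Xs"
  unfolding product_of_conn_graphs_def by (simp add: connected_imp_conn_graph)

lemma graph_iso_invariant: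
  assumes X: "pair_graph X" "Digraph_Component.connected (with_proj X)"
    and Y: "parcs Y \<subseteq> pverts Y \<times> pverts Y" and iso: "graph_iso X Y"
  shows "pair_graph Y \<and> Digraph_Component.connected (with_proj Y)" and "prod_classes Y = prod_classes X"
    and "card (pverts Y) = card (pverts X)"
proof -
  interpret X: conn_graph "pverts X" "parcs X" using X by (rule connected_imp_conn_graph)
  obtain h where h: "bij_betw h (pverts X) (pverts Y)"
    "\<And>u v. u \<in> pverts X \<Longrightarrow> v \<in> pverts X \<Longrightarrow> (u, v) \<in> parcs X \<longleftrightarrow> (h u, h v) \<in> parcs Y"
    using iso graph_iso_iff[OF X(1) Y] by blast
  have "pverts X \<noteq> {}" using X by (rule connected_imp_conn_graph)
  then have "pverts Y \<noteq> {}" using h(1) by (auto simp: bij_betw_def)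
  then show "pair_graph Y \<and> Digraph_Component.connected (with_proj Y)"
    using X.isomorphic_image(1)[OF h(1) Y h(2)] by (intro conn_graph_imp_connected)
  show "prod_classes Y = prod_classes X"
    using X.isomorphic_image(2)[OF h(1) Y h(2)] by (simp add: prod_classes_def)
  show "card (pverts Y) = card (pverts X)" using bij_betw_same_card[OF h(1)] by simp
qed

lemma cartesian_product_nonempty_iff:
  "pverts (cartesian_product Xs) = {} \<longleftrightarrow> (\<exists>Y\<in>set Xs. pverts Y = {})"
proof
  assume empty: "pverts (cartesian_product Xs) = {}"
  show "\<exists>Y\<in>set Xs. pverts Y = {}"
  proof (rule ccontr)
    assume "\<not> ?thesis"
    then have "map (\<lambda>Y. SOME v. v \<in> pverts Y) Xs \<in> pverts (cartesian_product Xs)"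
      by (auto simp: pverts_cartesian_product some_in_eq)
    then show False using empty by simp
  qed
qed (force simp: pverts_cartesian_product in_set_conv_nth)

lemma prod_classes_product:
  assumes "\<forall>Y\<in>set Xs. pair_graph Y \<and> Digraph_Component.connected (with_proj Y)"
  shows "pair_graph (cartesian_product Xs) \<and> Digraph_Component.connected (with_proj (cartesian_product Xs))"
    and "prod_classes (cartesian_product Xs) = sum_list (map prod_classes Xs)"
proof -
  interpret product_of_conn_graphs Xs using assms by (rule product_of_conn_graphsI)
  have ne: "PV \<noteq> {}"
    using assms connected_imp_conn_graph(2) by (auto simp: cartesian_product_nonempty_iff)
  then show "pair_graph (cartesian_product Xs) \<and> Digraph_Component.connected (with_proj (cartesian_product Xs))"
    using conn_graph_product by (intro conn_graph_imp_connected)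
  show "prod_classes (cartesian_product Xs) = sum_list (map prod_classes Xs)"
    using card_Classes_product[OF ne]
    by (simp add: prod_classes_def sum_list_sum_nth lessThan_atLeast0)
qed

text \<open>\<open>prime_graph\<close> quantifies over factors without asking for connectedness.
  Walks in the product project to walks in a factor, a step of the walk either staying in place or
  following an arc.\<close>

lemma factor_connected:
  assumes P: "Digraph_Component.connected (with_proj (cartesian_product Xs))"
    "pair_graph (cartesian_product Xs)"
    and Y: "Y \<in> set Xs" "pair_graph Y"
  shows "Digraph_Component.connected (with_proj Y)"
proof -
  have ne: "pverts (cartesian_product Xs) \<noteq> {}"
    and walk: "\<And>x y. x \<in> pverts (cartesian_product Xs) \<Longrightarrow> y \<in> pverts (cartesian_product Xs) \<Longrightarrow>
      (x, y) \<in> (parcs (cartesian_product Xs))\<^sup>*"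
    using P(1) connected_iff[OF P(2)] by simp_all
  obtain i where i: "i < length Xs" "Y = Xs ! i" using Y(1) by (metis in_set_conv_nth)
  obtain x where x: "x \<in> pverts (cartesian_product Xs)" using ne by blast
  have lx: "length x = length Xs" using x by (simp add: pverts_cartesian_product)
  have upd: "x[i := a] \<in> pverts (cartesian_product Xs)" if "a \<in> pverts Y" for a
    using x that i by (auto simp: pverts_cartesian_product nth_list_update)
  have proj: "(u ! i, v ! i) \<in> (parcs Y)\<^sup>*" if "(u, v) \<in> (parcs (cartesian_product Xs))\<^sup>*" for u v
    using that
  proof (induction rule: rtrancl_induct)
    case (step v w)
    then have "v ! i = w ! i \<or> (v ! i, w ! i) \<in> parcs Y"
      using i by (auto simp: parcs_cartesian_product)
    with step.IH show ?case by (auto intro: rtrancl.rtrancl_into_rtrancl)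
  qed simp
  have "(a, b) \<in> (parcs Y)\<^sup>*" if "a \<in> pverts Y" "b \<in> pverts Y" for a b
    using proj[OF walk[OF upd[OF that(1)] upd[OF that(2)]]] lx i by simp
  moreover have "pverts Y \<noteq> {}" using ne Y(1) by (auto simp: cartesian_product_nonempty_iff)
  ultimately show ?thesis using connected_iff[OF Y(2)] by blast
qed

lemma prod_classes_pos:
  assumes "pair_graph X" "Digraph_Component.connected (with_proj X)" "2 \<le> card (pverts X)"
  shows "prod_classes X \<ge> 1"
proof -
  interpret conn_graph "pverts X" "parcs X" using assms(1,2) by (rule connected_imp_conn_graph)
  obtain u v where uv: "u \<in> pverts X" "v \<in> pverts X" "u \<noteq> v"
    using assms(3) by (metis card_le_Suc0_iff_eq fin not_less_eq_eq numeral_2_eq_2)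
  then have "parcs X \<noteq> {}" using conn[OF uv(1,2)] by auto
  then have "Classes \<noteq> {}" using Union_Classes by blast
  then show ?thesis using finite_Classes by (simp add: prod_classes_def Suc_le_eq card_gt_0_iff)
qed

lemma decomposition_into_factors:
  assumes X: "pair_graph X" "Digraph_Component.connected (with_proj X)"
  obtains Xs :: "nat pair_pre_digraph list" where "length Xs = prod_classes X"
    and "\<forall>Y\<in>set Xs. pair_graph Y \<and> Digraph_Component.connected (with_proj Y) \<and> 2 \<le> card (pverts Y)"
    and "graph_iso X (cartesian_product Xs)"
proof -
  obtain Xs :: "nat pair_pre_digraph list" where
    "length Xs = card (parcs X // prod_rel (parcs X))"
    "\<forall>Y\<in>set Xs. pair_graph Y \<and> Digraph_Component.connected (with_proj Y) \<and> 2 \<le> card (pverts Y)"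
    "graph_iso \<lparr>pverts = pverts X, parcs = parcs X\<rparr> (cartesian_product Xs)"
    using conn_graph.decomposition[OF connected_imp_conn_graph[OF X]] by blast
  moreover have "\<lparr>pverts = pverts X, parcs = parcs X\<rparr> = X" by (cases X) simp
  ultimately show ?thesis by (intro that[of Xs]) (simp_all only: prod_classes_def)
qed

text \<open>A prime graph has a single factor in the decomposition by classes. Conversely, the
  factors of any decomposition have positive class counts with sum 1, and the empty product has
  count 0, so there is exactly one factor.\<close>

lemma prime_graph_iff:
  assumes X: "pair_graph X" "Digraph_Component.connected (with_proj X)"
  shows "prime_graph X \<longleftrightarrow> prod_classes X = 1"
proof
  assume "prime_graph X"
  then show "prod_classes X = 1"
    using decomposition_into_factors[OF X] unfolding prime_graph_def by metis
next
  assume one: "prod_classes X = 1"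
  show "prime_graph X"
    unfolding prime_graph_def
  proof (intro allI impI)
    fix Ys :: "nat pair_pre_digraph list"
    assume Ys: "(\<forall>Y\<in>set Ys. pair_graph Y \<and> 2 \<le> card (pverts Y)) \<and> graph_iso X (cartesian_product Ys)"
    then have iso: "graph_iso X (cartesian_product Ys)" by blast
    note inv = graph_iso_invariant[OF X cartesian_product_arcs_sub iso]
    have conn: "\<forall>Y\<in>set Ys. pair_graph Y \<and> Digraph_Component.connected (with_proj Y)"
      using inv(1) factor_connected Ys by blast
    have "sum_list (map (\<lambda>_. 1) Ys) \<le> sum_list (map prod_classes Ys)"
      using conn Ys prod_classes_pos by (intro sum_list_mono) auto
    also have "\<dots> = 1" using inv(2) prod_classes_product(2)[OF conn] one by simp
    finally have "length Ys \<le> 1" by (simp add: sum_list_triv)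
    moreover have "Ys \<noteq> []" using prod_classes_product(2)[OF conn] inv(2) one by auto
    ultimately show "length Ys = 1" by (cases Ys) auto
  qed
qed

lemma sum_list_pos_eq_length:
  fixes f :: "'a \<Rightarrow> nat"
  assumes "\<And>x. x \<in> set xs \<Longrightarrow> 1 \<le> f x" "sum_list (map f xs) = length xs"
  shows "\<forall>x\<in>set xs. f x = 1"
  using assms
proof (induction xs)
  case (Cons a xs)
  have "sum_list (map (\<lambda>_. 1) xs) \<le> sum_list (map f xs)"
    using Cons.prems by (intro sum_list_mono) auto
  then have "length xs \<le> sum_list (map f xs)" by (simp add: sum_list_triv)
  moreover have "1 \<le> f a" using Cons.prems by simp
  ultimately have "f a = 1 \<and> sum_list (map f xs) = length xs" using Cons.prems(2) by simp
  then show ?case using Cons by auto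
qed simp

text \<open>Primes have count 1, so by additivity \<open>k\<close> prime factors give count
  \<open>k\<close>. Conversely, the decomposition by classes has \<open>k\<close> factors with
  positive counts summing to \<open>k\<close>, so all counts are 1 and all factors prime.\<close>

theorem product_of_connected_primes_iff:
  assumes X: "pair_graph X"
  shows "product_of_connected_primes k X \<longleftrightarrow>
    Digraph_Component.connected (with_proj X) \<and> prod_classes X = k"
proof
  assume "product_of_connected_primes k X"
  then obtain Xs :: "nat pair_pre_digraph list" where Xs: "length Xs = k"
    "\<forall>Y\<in>set Xs. pair_graph Y \<and> Digraph_Component.connected (with_proj Y) \<and> prime_graph Y"
    and iso: "graph_iso X (cartesian_product Xs)"
    unfolding product_of_connected_primes_def by blast
  have conn: "\<forall>Y\<in>set Xs. pair_graph Y \<and> Digraph_Component.connected (with_proj Y)" using Xs by blast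
  note P = prod_classes_product[OF conn]
  \<comment> \<open>Isomorphism invariance starts from a graph known to be connected, which here is
    the product.\<close>
  have iso': "graph_iso (cartesian_product Xs) X"
    using iso unfolding graph_iso_def
    by (rule digraph_iso_swap[rotated])
      (use X[unfolded pair_graph_iff] in \<open>auto simp: wf_digraph_def\<close>)
  have "parcs X \<subseteq> pverts X \<times> pverts X" using X by (simp add: pair_graph_iff)
  note inv = graph_iso_invariant[OF _ _ this iso']
  have "map prod_classes Xs = map (\<lambda>_. 1) Xs" using Xs prime_graph_iff by auto
  then have "prod_classes (cartesian_product Xs) = sum_list (map (\<lambda>_. 1) Xs)"
    using P(2) by (simp only:)
  then have "prod_classes (cartesian_product Xs) = k"
    using Xs(1) by (simp add: sum_list_triv)
  then show "Digraph_Component.connected (with_proj X) \<and> prod_classes X = k"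
    using inv P(1) by simp
next
  assume *: "Digraph_Component.connected (with_proj X) \<and> prod_classes X = k"
  then obtain Xs :: "nat pair_pre_digraph list" where Xs: "length Xs = k"
    "\<forall>Y\<in>set Xs. pair_graph Y \<and> Digraph_Component.connected (with_proj Y) \<and> 2 \<le> card (pverts Y)"
    and iso: "graph_iso X (cartesian_product Xs)"
    using decomposition_into_factors[OF X] by metis
  have conn: "\<forall>Y\<in>set Xs. pair_graph Y \<and> Digraph_Component.connected (with_proj Y)" using Xs by blast
  have "sum_list (map prod_classes Xs) = length Xs"
    using prod_classes_product(2)[OF conn] Xs(1) *
      graph_iso_invariant(2)[OF X _ cartesian_product_arcs_sub iso] by simp
  then have "\<forall>Y\<in>set Xs. prod_classes Y = 1"
    using Xs(2) prod_classes_pos by (intro sum_list_pos_eq_length) auto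
  then have "\<forall>Y\<in>set Xs. prime_graph Y" using conn prime_graph_iff by blast
  then show "product_of_connected_primes k X"
    unfolding product_of_connected_primes_def using Xs iso by blast
qed

section \<open>Invariance under the Weisfeiler-Leman algorithm\<close>

locale alg_iso =
  fixes m :: nat and V :: "'a set" and P :: "'a list set set"
    and V' :: "'b set" and P' :: "'b list set set" and \<phi> :: "'a list set \<Rightarrow> 'b list set"
  assumes m_pos: "m \<ge> 1"
    and fin: "finite V" "finite V'"
    and cc: "coherent_configuration m V P" "coherent_configuration m V' P'"
    and iso: "algebraic_isomorphism m V P V' P' \<phi>"
begin

lemma part: "partition_on (tuples m V) P" "partition_on (tuples m V') P'"
  using cc by (auto simp: coherent_configuration_def)

lemma bij: "bij_betw \<phi> P P'"
  using iso by (simp add: algebraic_isomorphism_def)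

lemma \<phi>_in: "A \<in> P \<Longrightarrow> \<phi> A \<in> P'"
  using bij by (rule bij_betw_apply)

text \<open>The positions of the pebble game: two tuples of the same colour, one in each structure.
  In logical terms they satisfy the same counting formulas.\<close>

definition sim :: "'a list \<Rightarrow> 'b list \<Rightarrow> bool" where
  "sim x x' \<longleftrightarrow> (\<exists>A\<in>P. x \<in> A \<and> x' \<in> \<phi> A)"

lemma class_ex: "x \<in> tuples m V \<Longrightarrow> \<exists>A\<in>P. x \<in> A" "x' \<in> tuples m V' \<Longrightarrow> \<exists>A\<in>P'. x' \<in> A"
  unfolding partition_onD1[OF part(1)] partition_onD1[OF part(2)] by blast+

lemma class_unique: "A \<in> P \<Longrightarrow> B \<in> P \<Longrightarrow> x \<in> A \<Longrightarrow> x \<in> B \<Longrightarrow> A = B"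
  "C \<in> P' \<Longrightarrow> D \<in> P' \<Longrightarrow> x' \<in> C \<Longrightarrow> x' \<in> D \<Longrightarrow> C = D"
  using partition_onD2[OF part(1)] partition_onD2[OF part(2)]
  by (metis disjointD disjoint_iff)+

lemma sim_tuples:
  assumes "sim x x'"
  shows "x \<in> tuples m V" and "x' \<in> tuples m V'"
proof -
  obtain A where "A \<in> P" "x \<in> A" "x' \<in> \<phi> A" using assms by (auto simp: sim_def)
  then show "x \<in> tuples m V" "x' \<in> tuples m V'"
    using \<phi>_in part by (auto simp: partition_on_def)
qed

lemma sim_length: "sim x x' \<Longrightarrow> length x = m" "sim x x' \<Longrightarrow> length x' = m"
  using sim_tuples by (auto simp: tuples_def)

lemma sim_same_class:
  assumes "sim x x'" "sim y x'"
  obtains A where "A \<in> P" "x \<in> A" "y \<in> A"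
proof -
  obtain A B where AB: "A \<in> P" "B \<in> P" "x \<in> A" "y \<in> B" "x' \<in> \<phi> A" "x' \<in> \<phi> B"
    using assms unfolding sim_def by blast
  then have "\<phi> A = \<phi> B" using class_unique(2) \<phi>_in by blast
  then have "A = B" using AB bij by (meson bij_betw_imp_inj_on inj_onD)
  then show ?thesis using AB that by blast
qed

lemma sim_same_class':
  assumes "sim x x'" "sim x y'"
  obtains A where "A \<in> P'" "x' \<in> A" "y' \<in> A"
  using assms class_unique(1) \<phi>_in unfolding sim_def by metis

lemma class_eq_type:
  assumes "A \<in> P" "x \<in> A" "y \<in> A" "i < m" "j < m"
  shows "x ! i = x ! j \<longleftrightarrow> y ! i = y ! j"
  by (rule cc(1)[unfolded coherent_configuration_def, THEN conjunct2, THEN conjunct1,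
        rule_format, OF assms])

lemma class_eq_type':
  assumes "A \<in> P'" "x \<in> A" "y \<in> A" "i < m" "j < m"
  shows "x ! i = x ! j \<longleftrightarrow> y ! i = y ! j"
  by (rule cc(2)[unfolded coherent_configuration_def, THEN conjunct2, THEN conjunct1,
        rule_format, OF assms])

lemma subst_count_class:
  assumes "A \<in> P" "x \<in> A" "y \<in> A" "\<forall>i<m. C i \<in> P"
  shows "subst_count m V C x = subst_count m V C y"
  by (rule cc(1)[unfolded coherent_configuration_def, THEN conjunct2, THEN conjunct2, THEN conjunct2,
        rule_format, OF assms(1) _ assms(2,3)]) (use assms(4) in simp)

lemma subst_count_class':
  assumes "A \<in> P'" "x \<in> A" "y \<in> A" "\<forall>i<m. C i \<in> P'"
  shows "subst_count m V' C x = subst_count m V' C y"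
  by (rule cc(2)[unfolded coherent_configuration_def, THEN conjunct2, THEN conjunct2, THEN conjunct2,
        rule_format, OF assms(1) _ assms(2,3)]) (use assms(4) in simp)

text \<open>Coherence makes the counts constant on a class, so the definite description in
  \<open>intersection_number\<close> yields the count at any of its tuples.\<close>

lemma subst_count_eq:
  assumes A: "A \<in> P" and C: "\<forall>i<m. C i \<in> P" and x: "x \<in> A" and x': "x' \<in> \<phi> A"
  shows "subst_count m V C x = subst_count m V' (\<lambda>i. \<phi> (C i)) x'"
proof -
  have "subst_count m V C y = subst_count m V C x" if "y \<in> A" for y
    using subst_count_class[OF A that x C] .
  then have "intersection_number m V A C = subst_count m V C x"
    unfolding intersection_number_def using x by (intro THE_const_on)
  moreover have "\<forall>i<m. \<phi> (C i) \<in> P'" using C \<phi>_in by blast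
  then have "subst_count m V' (\<lambda>i. \<phi> (C i)) y = subst_count m V' (\<lambda>i. \<phi> (C i)) x'" if "y \<in> \<phi> A" for y
    using subst_count_class'[OF \<phi>_in[OF A] that x'] by simp
  then have "intersection_number m V' (\<phi> A) (\<lambda>i. \<phi> (C i)) = subst_count m V' (\<lambda>i. \<phi> (C i)) x'"
    unfolding intersection_number_def using x' by (intro THE_const_on)
  moreover have "intersection_number m V A C = intersection_number m V' (\<phi> A) (\<lambda>i. \<phi> (C i))"
    by (rule iso[unfolded algebraic_isomorphism_def, THEN conjunct2, rule_format, OF A]) (use C in simp)
  ultimately show ?thesis by simp
qed

text \<open>One move of the bijective game. Vertices are sorted by the list of classes of all
  \<open>m\<close> substituted tuples; intersection numbers give the sizes of the fibres, so fibres
  correspond. The same \<open>f\<close> works for every position \<open>i\<close>, which is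
  essential for recovering equality types.\<close>

lemma sim_extend:
  assumes "sim x x'"
  obtains f where "bij_betw f V V'" "\<And>a i. a \<in> V \<Longrightarrow> i < m \<Longrightarrow> sim (x[i := a]) (x'[i := f a])"
proof -
  obtain A where A: "A \<in> P" "x \<in> A" "x' \<in> \<phi> A" using assms by (auto simp: sim_def)
  have "\<exists>B. x \<in> tuples m V \<longrightarrow> B \<in> P \<and> x \<in> B" for x using class_ex by blast
  then obtain cl where cl: "\<And>x. x \<in> tuples m V \<Longrightarrow> cl x \<in> P \<and> x \<in> cl x" by metis
  have "\<exists>B. x \<in> tuples m V' \<longrightarrow> B \<in> P' \<and> x \<in> B" for x using class_ex by blast
  then obtain cl' where cl': "\<And>x. x \<in> tuples m V' \<Longrightarrow> cl' x \<in> P' \<and> x \<in> cl' x" by metis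
  define F where "F a = map (\<lambda>i. \<phi> (cl (x[i := a]))) [0..<m]" for a
  define G where "G a = map (\<lambda>i. cl' (x'[i := a])) [0..<m]" for a
  have tx: "x[i := a] \<in> tuples m V" if "a \<in> V" for a i
    using sim_tuples[OF assms] that by (simp add: tuples_update)
  have tx': "x'[i := a] \<in> tuples m V'" if "a \<in> V'" for a i
    using sim_tuples[OF assms] that by (simp add: tuples_update)
  have "card {a \<in> V. F a = c} = card {b \<in> V'. G b = c}" for c
  proof (cases "length c = m \<and> (\<forall>i<m. c ! i \<in> P')")
    case True
    define C where "C i = inv_into P \<phi> (c ! i)" for i
    have C: "C i \<in> P" "\<phi> (C i) = c ! i" if "i < m" for i
      using True that bij by (auto simp: C_def bij_betw_def f_inv_into_f inv_into_into)
    have "F a = c \<longleftrightarrow> (\<forall>i<m. x[i := a] \<in> C i)" if a: "a \<in> V" for a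
    proof -
      have "F a = c \<longleftrightarrow> (\<forall>i<m. \<phi> (cl (x[i := a])) = \<phi> (C i))"
        using True C by (auto simp: F_def list_eq_iff_nth_eq)
      also have "\<dots> \<longleftrightarrow> (\<forall>i<m. cl (x[i := a]) = C i)"
        using C cl[OF tx[OF a]] bij by (metis bij_betw_imp_inj_on inj_onD)
      also have "\<dots> \<longleftrightarrow> (\<forall>i<m. x[i := a] \<in> C i)"
        using C cl[OF tx[OF a]] class_unique(1) by metis
      finally show ?thesis .
    qed
    then have 1: "card {a \<in> V. F a = c} = subst_count m V C x"
      unfolding subst_count_def by (intro arg_cong[where f = card]) blast
    have "G b = c \<longleftrightarrow> (\<forall>i<m. x'[i := b] \<in> \<phi> (C i))" if b: "b \<in> V'" for b
    proof -
      have "G b = c \<longleftrightarrow> (\<forall>i<m. cl' (x'[i := b]) = \<phi> (C i))"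
        using True C by (auto simp: G_def list_eq_iff_nth_eq)
      also have "\<dots> \<longleftrightarrow> (\<forall>i<m. x'[i := b] \<in> \<phi> (C i))"
        using C \<phi>_in cl'[OF tx'[OF b]] class_unique(2) by metis
      finally show ?thesis .
    qed
    then have 2: "card {b \<in> V'. G b = c} = subst_count m V' (\<lambda>i. \<phi> (C i)) x'"
      unfolding subst_count_def by (intro arg_cong[where f = card]) blast
    show ?thesis using 1 2 subst_count_eq[OF A(1) _ A(2,3)] C by simp
  next
    case False
    \<comment> \<open>A list that is not a list of \<open>m\<close> classes of \<open>P'\<close> has
      an empty fibre on both sides.\<close>
    have "F a \<noteq> c" if "a \<in> V" for a
      using False \<phi>_in cl[OF tx[OF that]] by (auto simp: F_def)
    moreover have "G b \<noteq> c" if "b \<in> V'" for b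
      using False cl'[OF tx'[OF that]] by (auto simp: G_def)
    ultimately show ?thesis by (metis (mono_tags, lifting) Collect_empty_eq card.empty)
  qed
  then obtain f where f: "bij_betw f V V'" "\<forall>a\<in>V. G (f a) = F a"
    using ex_bij_betw_fibres[OF fin] by blast
  have "sim (x[i := a]) (x'[i := f a])" if a: "a \<in> V" and i: "i < m" for a i
  proof -
    have "G (f a) ! i = F a ! i" using f a by simp
    then have "cl' (x'[i := f a]) = \<phi> (cl (x[i := a]))" using i by (simp add: F_def G_def)
    moreover have "f a \<in> V'" using f(1) a by (rule bij_betw_apply)
    ultimately have "x'[i := f a] \<in> \<phi> (cl (x[i := a]))" using cl' tx' by metis
    then show ?thesis using cl[OF tx[OF a]] unfolding sim_def by blast
  qed
  with f(1) show ?thesis by (rule that)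
qed

lemma sim_forth:
  assumes "sim x x'" "a \<in> V" "k < m"
  shows "\<exists>b\<in>V'. sim (x[k := a]) (x'[k := b])"
proof -
  obtain f where "bij_betw f V V'" "sim (x[k := a]) (x'[k := f a])"
    using sim_extend[OF assms(1)] assms(2,3) by metis
  then show ?thesis using assms(2) bij_betw_apply by fast
qed

lemma sim_back:
  assumes "sim x x'" "b \<in> V'" "k < m"
  shows "\<exists>a\<in>V. sim (x[k := a]) (x'[k := b])"
proof -
  obtain f where f: "bij_betw f V V'" "\<And>a i. a \<in> V \<Longrightarrow> i < m \<Longrightarrow> sim (x[i := a]) (x'[i := f a])"
    using sim_extend[OF assms(1)] by blast
  have "b \<in> f ` V" using bij_betw_imp_surj_on[OF f(1)] assms(2) by simp
  then show ?thesis using f(2) assms(3) by auto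
qed

text \<open>The quantifier step: a bound vertex is stored by overwriting position
  \<open>k\<close>.\<close>

lemma sim_ex_iff:
  assumes "sim x x'" "k < m" "\<And>y y'. sim y y' \<Longrightarrow> Q y \<longleftrightarrow> Q' y'"
  shows "(\<exists>a\<in>V. Q (x[k := a])) \<longleftrightarrow> (\<exists>b\<in>V'. Q' (x'[k := b]))"
  using assms sim_forth sim_back by meson

text \<open>
  Algebraic isomorphisms are not required to respect equality types. They do, since for
  \<open>x ! i = x ! j\<close> with \<open>i \<noteq> j\<close> the tuple \<open>x[i := a]\<close> can lie in the class of \<open>x\<close> only if \<open>a = x ! j\<close>.
\<close>
lemma sim_eq_iff:
  assumes s: "sim x x'" and ij: "i < m" "j < m"
  shows "x ! i = x ! j \<longleftrightarrow> x' ! i = x' ! j"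
proof (cases "i = j")
  case False
  have len: "length x = m" "length x' = m" using sim_length[OF s] .
  have x: "x ! i \<in> V" "x' ! i \<in> V'" using sim_tuples[OF s] ij tuples_nth by blast+
  obtain f where f: "bij_betw f V V'" "\<And>a i. a \<in> V \<Longrightarrow> i < m \<Longrightarrow> sim (x[i := a]) (x'[i := f a])"
    using sim_extend[OF s] by blast
  show ?thesis
  proof
    assume eq: "x ! i = x ! j"
    obtain a where a: "a \<in> V" "f a = x' ! i" using f(1) x(2) by (metis bij_betw_iff_bijections)
    have "sim (x[i := a]) x'" using f(2)[OF a(1) ij(1)] a(2) by simp
    then obtain A where "A \<in> P" "x[i := a] \<in> A" "x \<in> A" using sim_same_class s by blast
    then have "x[i := a] ! i = x[i := a] ! j" using class_eq_type eq ij by blast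
    then have "a = x ! j" using len ij False by simp
    \<comment> \<open>The same \<open>f\<close> is now used at position \<open>j\<close>: since
      \<open>a = x ! j\<close>, this update leaves \<open>x\<close> unchanged, and on the other side
      it makes positions \<open>i\<close> and \<open>j\<close> equal.\<close>
    then have "sim x (x'[j := x' ! i])" using f(2)[OF a(1) ij(2)] a(2) by simp
    then obtain B where "B \<in> P'" "x'[j := x' ! i] \<in> B" "x' \<in> B" using sim_same_class' s by blast
    then have "x' ! i = x' ! j \<longleftrightarrow> x'[j := x' ! i] ! i = x'[j := x' ! i] ! j"
      using class_eq_type' ij by blast
    then show "x' ! i = x' ! j" using len ij False by simp
  next
    assume eq: "x' ! i = x' ! j"
    have "sim x (x'[i := f (x ! i)])" using f(2)[OF x(1) ij(1)] by simp
    then obtain B where "B \<in> P'" "x'[i := f (x ! i)] \<in> B" "x' \<in> B" using sim_same_class' s by blast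
    then have "x'[i := f (x ! i)] ! i = x'[i := f (x ! i)] ! j" using class_eq_type' eq ij by blast
    then have "f (x ! i) = x' ! j" using len ij False by simp
    then have "sim (x[j := x ! i]) x'" using f(2)[OF x(1) ij(2)] by simp
    then obtain A where "A \<in> P" "x[j := x ! i] \<in> A" "x \<in> A" using sim_same_class s by blast
    then have "x ! i = x ! j \<longleftrightarrow> x[j := x ! i] ! i = x[j := x ! i] ! j"
      using class_eq_type ij by blast
    then show "x ! i = x ! j" using len ij False by simp
  qed
qed simp

text \<open>The move answering the new entry at \<open>k\<close> is forced to be
  \<open>x' ! i\<close> by the equality of positions \<open>k\<close> and \<open>i\<close>. In this
  way \<open>\<phi>\<close> respects the copying of coordinates.\<close>

lemma sim_copy:
  assumes s: "sim x x'" and ik: "i < m" "k < m"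
  shows "sim (x[k := x ! i]) (x'[k := x' ! i])"
proof (cases "k = i")
  case False
  have "x ! i \<in> V" using sim_tuples[OF s] ik tuples_nth by blast
  then obtain b where b: "sim (x[k := x ! i]) (x'[k := b])" using sim_forth[OF s] ik by blast
  have "b = x' ! i" using sim_eq_iff[OF b ik(2,1)] sim_length[OF s] ik False by simp
  then show ?thesis using b by simp
qed (use s in simp)

lemma sim_ex: "V \<noteq> {} \<Longrightarrow> \<exists>x x'. sim x x'" "V' \<noteq> {} \<Longrightarrow> \<exists>x x'. sim x x'"
proof -
  assume "V \<noteq> {}"
  then obtain v where "v \<in> V" by blast
  then have "replicate m v \<in> tuples m V" by (auto simp: tuples_def)
  then obtain A where A: "A \<in> P" "replicate m v \<in> A" using class_ex by blast
  have "\<phi> A \<noteq> {}" using \<phi>_in[OF A(1)] part(2) partition_onD3 by metis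
  then show "\<exists>x x'. sim x x'" using A unfolding sim_def by blast
next
  assume "V' \<noteq> {}"
  then obtain v where "v \<in> V'" by blast
  then have "replicate m v \<in> tuples m V'" by (auto simp: tuples_def)
  then obtain B where B: "B \<in> P'" "replicate m v \<in> B" using class_ex by blast
  then obtain A where A: "A \<in> P" "B = \<phi> A" using bij by (auto simp: bij_betw_def)
  have "A \<noteq> {}" using A(1) part(1) partition_onD3 by metis
  then show "\<exists>x x'. sim x x'" using A B unfolding sim_def by blast
qed

lemma V_empty_iff: "V = {} \<longleftrightarrow> V' = {}"
proof -
  have "V \<noteq> {} \<and> V' \<noteq> {}" if "sim x x'" for x x'
    using sim_tuples[OF that] m_pos by (auto simp: tuples_def)
  then show ?thesis using sim_ex by blast
qed

text \<open>Two moves in succession; the second bijection depends on the vertex chosen in the first.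
  This is the form in which pairs of vertices, hence arcs, are counted.\<close>

lemma sim_extend_pair:
  assumes s: "sim x x'" and ij: "i < m" "j < m"
  obtains h where "bij_betw h (V \<times> V) (V' \<times> V')"
    and "\<And>p. p \<in> V \<times> V \<Longrightarrow> sim (x[i := fst p, j := snd p]) (x'[i := fst (h p), j := snd (h p)])"
proof -
  obtain f where f: "bij_betw f V V'" "\<And>a i. a \<in> V \<Longrightarrow> i < m \<Longrightarrow> sim (x[i := a]) (x'[i := f a])"
    using sim_extend[OF s] by blast
  have "\<exists>g. a \<in> V \<longrightarrow> bij_betw g V V' \<and> (\<forall>b\<in>V. sim (x[i := a, j := b]) (x'[i := f a, j := g b]))" for a
    using f(2)[OF _ ij(1)] sim_extend ij(2) by metis
  then obtain g where g: "\<And>a. a \<in> V \<Longrightarrow> bij_betw (g a) V V'"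
    "\<And>a b. a \<in> V \<Longrightarrow> b \<in> V \<Longrightarrow> sim (x[i := a, j := b]) (x'[i := f a, j := g a b])" by metis
  let ?h = "\<lambda>p. (f (fst p), g (fst p) (snd p))"
  have "bij_betw ?h (V \<times> V) (V' \<times> V')"
  proof (rule bij_betw_imageI)
    show "inj_on ?h (V \<times> V)"
      using bij_betw_imp_inj_on[OF f(1)] bij_betw_imp_inj_on[OF g(1)]
      by (auto simp: inj_on_def)
    show "?h ` (V \<times> V) = V' \<times> V'"
    proof
      show "?h ` (V \<times> V) \<subseteq> V' \<times> V'" using bij_betw_apply[OF f(1)] bij_betw_apply[OF g(1)] by auto
      show "V' \<times> V' \<subseteq> ?h ` (V \<times> V)"
      proof
        fix q assume q: "q \<in> V' \<times> V'"
        then have "fst q \<in> f ` V" using bij_betw_imp_surj_on[OF f(1)] by auto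
        then obtain a where a: "a \<in> V" "fst q = f a" by blast
        have "snd q \<in> g a ` V" using bij_betw_imp_surj_on[OF g(1)[OF a(1)]] q by auto
        then obtain b where b: "b \<in> V" "snd q = g a b" by blast
        have "q = ?h (a, b)" using a b by (simp add: prod_eq_iff)
        then show "q \<in> ?h ` (V \<times> V)" using a b by blast
      qed
    qed
  qed
  then show ?thesis by (rule that) (use g(2) in auto)
qed

end


section \<open>Transfer of arcs, distances and classes between equivalent graphs\<close>

lemma WL_class_arcs:
  assumes fin: "finite (pverts X)" and A: "A \<in> WL m X" and xy: "x \<in> A" "y \<in> A"
    and ij: "i < m" "j < m"
  shows "(x ! i, x ! j) \<in> parcs X \<longleftrightarrow> (y ! i, y ! j) \<in> parcs X"
proof -
  obtain N where N: "(\<Inter>r. wl_round m X r) = wl_round m X N"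
    using wl_round_stabilises[OF fin] by metis
  have "(x, y) \<in> (\<Inter>r. wl_round m X r)"
    using quotient_eq_iff[OF equiv_wl_round, of A m X N A x y] A xy unfolding WL_def N by simp
  then have "(x, y) \<in> wl_round m X 0" by blast
  then show ?thesis using ij by (simp add: wl_round_0 wl_initial_def)
qed

locale wl_equiv_graphs =
  fixes m :: nat and X :: "'a pair_pre_digraph" and X' :: "'b pair_pre_digraph"
    and \<phi> :: "'a list set \<Rightarrow> 'b list set"
  assumes m: "m \<ge> 6" and X: "pair_graph X" "pair_graph X'"
    and \<phi>: "algebraic_isomorphism m (pverts X) (WL m X) (pverts X') (WL m X') \<phi>"
    and arcs: "(\<Union>A\<in>{A \<in> WL m X. pr2 A \<subseteq> parcs X}. pr2 (\<phi> A)) = parcs X'"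
begin

abbreviation "V \<equiv> pverts X"
abbreviation "E \<equiv> parcs X"
abbreviation "V' \<equiv> pverts X'"
abbreviation "E' \<equiv> parcs X'"

lemma graph: "finite V" "finite V'" "E \<subseteq> V \<times> V" "E' \<subseteq> V' \<times> V'" "sym E" "sym E'"
  using X pair_graph_iff[of X] pair_graph_iff[of X'] by simp_all

sublocale alg_iso m V "WL m X" V' "WL m X'" \<phi>
  using m graph(1,2) coherent_configuration_WL[OF graph(1)] coherent_configuration_WL[OF graph(2)] \<phi>
  by unfold_locales simp_all

text \<open>The hypothesis on arcs sees only two coordinates of some tuple \<open>y'\<close>. The
  remaining coordinates are replaced one by one by those of \<open>x'\<close>, each by a back move
  that leaves positions 0 and 1 of the partner alone.\<close>

lemma sim_same_prefix:
  assumes s: "sim y y'" and x': "x' \<in> tuples m V'" and eq: "y' ! 0 = x' ! 0" "y' ! 1 = x' ! 1"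
  shows "\<exists>z. sim z x' \<and> z ! 0 = y ! 0 \<and> z ! 1 = y ! 1"
proof -
  have "\<exists>z w. sim z w \<and> z ! 0 = y ! 0 \<and> z ! 1 = y ! 1 \<and> (\<forall>i<m. i < n \<or> i < 2 \<longrightarrow> w ! i = x' ! i)"
    for n
  proof (induction n)
    case 0
    have "y' ! i = x' ! i" if "i < 2" for i using eq that by (auto simp: less_2_cases_iff)
    then show ?case using s by auto
  next
    case (Suc n)
    then obtain z w where zw: "sim z w" "z ! 0 = y ! 0" "z ! 1 = y ! 1"
      "\<forall>i<m. i < n \<or> i < 2 \<longrightarrow> w ! i = x' ! i" by blast
    show ?case
    proof (cases "n < 2 \<or> n \<ge> m")
      case True
      then have "\<forall>i<m. i < Suc n \<or> i < 2 \<longrightarrow> w ! i = x' ! i" using zw(4) less_Suc_eq by auto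
      then show ?thesis using zw by blast
    next
      case False
      then obtain a where a: "sim (z[n := a]) (w[n := x' ! n])"
        using sim_back[OF zw(1) tuples_nth[OF x'], of n n] by auto
      have "\<forall>i<m. i < Suc n \<or> i < 2 \<longrightarrow> w[n := x' ! n] ! i = x' ! i"
        using False zw(4) sim_length[OF zw(1)] by (auto simp: nth_list_update less_Suc_eq)
      moreover have "z[n := a] ! 0 = y ! 0" "z[n := a] ! 1 = y ! 1" using False zw by auto
      ultimately show ?thesis using a by blast
    qed
  qed
  from this[of m] obtain z w where zw: "sim z w" "z ! 0 = y ! 0" "z ! 1 = y ! 1"
    "\<forall>i<m. w ! i = x' ! i" by auto
  have "w = x'"
    using zw(4) sim_length[OF zw(1)] x' by (intro nth_equalityI) (auto simp: tuples_def)
  then show ?thesis using zw by blast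
qed

text \<open>The hypothesis \<open>arcs\<close> equates unions of projections, so an arc at
  \<open>x'\<close> may be witnessed by a class other than that of \<open>x\<close>. Changing the
  later coordinates leads to a partner of \<open>x'\<close> that starts with an arc and lies in the
  class of \<open>x\<close>.\<close>

lemma sim_arc_01:
  assumes s: "sim x x'"
  shows "(x ! 0, x ! 1) \<in> E \<longleftrightarrow> (x' ! 0, x' ! 1) \<in> E'"
proof
  assume e: "(x ! 0, x ! 1) \<in> E"
  obtain A where A: "A \<in> WL m X" "x \<in> A" "x' \<in> \<phi> A" using s by (auto simp: sim_def)
  have "pr2 A \<subseteq> E"
    using WL_class_arcs[OF graph(1) A(1,2), of _ 0 1] e m by (auto simp: pr2_def)
  moreover have "(x' ! 0, x' ! 1) \<in> pr2 (\<phi> A)" using A(3) by (auto simp: pr2_def)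
  ultimately show "(x' ! 0, x' ! 1) \<in> E'" using arcs A(1) by blast
next
  assume "(x' ! 0, x' ! 1) \<in> E'"
  then obtain A where A: "A \<in> WL m X" "pr2 A \<subseteq> E" "(x' ! 0, x' ! 1) \<in> pr2 (\<phi> A)"
    using arcs by blast
  then obtain y' where y': "y' \<in> \<phi> A" "y' ! 0 = x' ! 0" "y' ! 1 = x' ! 1" by (auto simp: pr2_def)
  have "A \<noteq> {}" using A(1) part(1) partition_onD3 by metis
  then obtain y where y: "y \<in> A" by blast
  then have "sim y y'" using A(1) y' by (auto simp: sim_def)
  then obtain z where z: "sim z x'" "z ! 0 = y ! 0" "z ! 1 = y ! 1"
    using sim_same_prefix[OF _ sim_tuples(2)[OF s] y'(2,3)] by blast
  obtain B where B: "B \<in> WL m X" "x \<in> B" "z \<in> B" using sim_same_class[OF s z(1)] .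
  have "(z ! 0, z ! 1) \<in> E" using z y A(2) by (auto simp: pr2_def)
  then show "(x ! 0, x ! 1) \<in> E" using WL_class_arcs[OF graph(1) B, of 0 1] m by simp
qed

text \<open>Copying coordinates and the symmetry of the arc sets carry the statement from positions
  0 and 1 to all pairs.\<close>

lemma sim_arc:
  assumes s: "sim x x'" and ij: "i < m" "j < m"
  shows "(x ! i, x ! j) \<in> E \<longleftrightarrow> (x' ! i, x' ! j) \<in> E'"
proof -
  define Arc where "Arc i j \<longleftrightarrow> (\<forall>x x'. sim x x' \<longrightarrow> ((x ! i, x ! j) \<in> E \<longleftrightarrow> (x' ! i, x' ! j) \<in> E'))" for i j
  have sym: "Arc i j \<Longrightarrow> Arc j i" for i j
    using graph(5,6) unfolding Arc_def sym_def by blast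
  have copy: "Arc i j" if "Arc k j" "i < m" "k < m" "k \<noteq> j" for i j k
    unfolding Arc_def
  proof (intro allI impI)
    fix x x' assume s: "sim x x'"
    have "(x[k := x ! i] ! k, x[k := x ! i] ! j) \<in> E \<longleftrightarrow> (x'[k := x' ! i] ! k, x'[k := x' ! i] ! j) \<in> E'"
      using that(1) sim_copy[OF s that(2,3)] unfolding Arc_def by blast
    then show "(x ! i, x ! j) \<in> E \<longleftrightarrow> (x' ! i, x' ! j) \<in> E'"
      using sim_length[OF s] that by simp
  qed
  have "Arc 0 1" using sim_arc_01 by (simp add: Arc_def)
  then have to1: "Arc i 1" if "i < m" for i using copy[of 0 1 i] that by simp
  have "Arc j i"
  proof (cases "i = 1")
    case False
    then show ?thesis using copy[OF sym[OF to1[OF ij(1)]] ij(2)] m by simp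
  qed (use to1 ij in simp)
  then show ?thesis using sym s unfolding Arc_def by blast
qed

lemma sim_relpow:
  assumes "sim x x'" "i < m" "j < m"
  shows "(x ! i, x ! j) \<in> E ^^ n \<longleftrightarrow> (x' ! i, x' ! j) \<in> E' ^^ n"
  using assms
proof (induction n arbitrary: x x' i j)
  case 0
  then show ?case using sim_eq_iff by simp
next
  case (Suc n)
  obtain k where k: "k < m" "k \<notin> {i, i, i, i, j}"
    using ex_fresh_index[OF m] .
  note len = sim_length[OF Suc.prems(1)]
  have "(x ! i, x ! j) \<in> E ^^ Suc n \<longleftrightarrow> (\<exists>a\<in>V. (x ! i, a) \<in> E ^^ n \<and> (a, x ! j) \<in> E)"
    using graph(3) by auto
  also have "\<dots> \<longleftrightarrow> (\<exists>a\<in>V. (x[k := a] ! i, x[k := a] ! k) \<in> E ^^ n \<and> (x[k := a] ! k, x[k := a] ! j) \<in> E)"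
    using k len by simp
  also have "\<dots> \<longleftrightarrow> (\<exists>a\<in>V'. (x'[k := a] ! i, x'[k := a] ! k) \<in> E' ^^ n \<and> (x'[k := a] ! k, x'[k := a] ! j) \<in> E')"
    by (rule sim_ex_iff[where
          Q = "\<lambda>y. (y ! i, y ! k) \<in> E ^^ n \<and> (y ! k, y ! j) \<in> E" and
          Q' = "\<lambda>y. (y ! i, y ! k) \<in> E' ^^ n \<and> (y ! k, y ! j) \<in> E'", OF Suc.prems(1) k(1)])
      (use Suc.IH sim_arc Suc.prems k(1) in simp)
  also have "\<dots> \<longleftrightarrow> (\<exists>a\<in>V'. (x' ! i, a) \<in> E' ^^ n \<and> (a, x' ! j) \<in> E')"
    using k len by simp
  also have "\<dots> \<longleftrightarrow> (x' ! i, x' ! j) \<in> E' ^^ Suc n"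
    using graph(4) by auto
  finally show ?case .
qed

lemma sim_gdist: "sim x x' \<Longrightarrow> i < m \<Longrightarrow> j < m \<Longrightarrow> gdist E (x ! i) (x ! j) = gdist E' (x' ! i) (x' ! j)"
  unfolding gdist_def using sim_relpow by simp

text \<open>The common neighbour is compared only with the vertices at \<open>a\<close>,
  \<open>b\<close> and \<open>d\<close>, so the fresh position may overwrite any other, including
  \<open>c\<close>. This economy keeps the closure within six positions.\<close>

lemma sim_prod_step:
  assumes s: "sim x x'" and ix: "a < m" "b < m" "c < m" "d < m"
  shows "((x ! a, x ! b), (x ! c, x ! d)) \<in> prod_step E \<longleftrightarrow> ((x' ! a, x' ! b), (x' ! c, x' ! d)) \<in> prod_step E'"
proof -
  obtain k where k: "k < m" "k \<notin> {a, a, a, b, d}"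
    using ex_fresh_index[OF m] .
  note len = sim_length[OF s]
  have "(\<exists>w. (x ! b, w) \<in> E \<and> (w, x ! d) \<in> E \<and> w \<noteq> x ! a) \<longleftrightarrow>
      (\<exists>w\<in>V. (x[k := w] ! b, x[k := w] ! k) \<in> E \<and> (x[k := w] ! k, x[k := w] ! d) \<in> E \<and> x[k := w] ! k \<noteq> x[k := w] ! a)"
    using k len graph(3) by auto
  also have "\<dots> \<longleftrightarrow> (\<exists>w\<in>V'. (x'[k := w] ! b, x'[k := w] ! k) \<in> E' \<and> (x'[k := w] ! k, x'[k := w] ! d) \<in> E' \<and>
      x'[k := w] ! k \<noteq> x'[k := w] ! a)"
    by (rule sim_ex_iff[where
          Q = "\<lambda>y. (y ! b, y ! k) \<in> E \<and> (y ! k, y ! d) \<in> E \<and> y ! k \<noteq> y ! a" and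
          Q' = "\<lambda>y. (y ! b, y ! k) \<in> E' \<and> (y ! k, y ! d) \<in> E' \<and> y ! k \<noteq> y ! a", OF s k(1)])
      (use sim_arc sim_eq_iff ix k(1) in simp)
  also have "\<dots> \<longleftrightarrow> (\<exists>w. (x' ! b, w) \<in> E' \<and> (w, x' ! d) \<in> E' \<and> w \<noteq> x' ! a)"
    using k len graph(4) by auto
  finally have "(\<forall>w. (x ! b, w) \<in> E \<and> (w, x ! d) \<in> E \<longrightarrow> w = x ! a) \<longleftrightarrow>
      (\<forall>w. (x' ! b, w) \<in> E' \<and> (w, x' ! d) \<in> E' \<longrightarrow> w = x' ! a)" by blast
  then show ?thesis
    unfolding prod_step_def using sim_arc[OF s] sim_gdist[OF s] sim_eq_iff[OF s] ix by simp
qed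

text \<open>Six indices are needed here: two arcs and one arc between them on a path of steps.\<close>
lemma sim_relpow_prod_step:
  assumes "sim x x'" "a < m" "b < m" "c < m" "d < m"
  shows "((x ! a, x ! b), (x ! c, x ! d)) \<in> prod_step E ^^ n \<longleftrightarrow>
    ((x' ! a, x' ! b), (x' ! c, x' ! d)) \<in> prod_step E' ^^ n"
  using assms
proof (induction n arbitrary: x x' a b c d)
  case 0
  then show ?case using sim_eq_iff by simp
next
  case (Suc n)
  obtain k where k: "k < m" "k \<notin> {a, a, b, c, d}"
    using ex_fresh_index[OF m] .
  \<comment> \<open>Positions \<open>a\<close>, \<open>b\<close>, \<open>c\<close>,
    \<open>d\<close>, \<open>k\<close> may be distinct, and \<open>l\<close> is the sixth; here
    \<open>m \<ge> 6\<close> is used in full. Each of the two conditions in \<open>Q\<close>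
    concerns two arcs, and its own transfer may overwrite the ends of the third.\<close>
  obtain l where l: "l < m" "l \<notin> {a, b, c, d, k}"
    using ex_fresh_index[OF m] .
  define Q where "Q y \<longleftrightarrow> ((y ! a, y ! b), (y ! k, y ! l)) \<in> prod_step E ^^ n \<and>
    ((y ! k, y ! l), (y ! c, y ! d)) \<in> prod_step E" for y
  define Q' where "Q' y \<longleftrightarrow> ((y ! a, y ! b), (y ! k, y ! l)) \<in> prod_step E' ^^ n \<and>
    ((y ! k, y ! l), (y ! c, y ! d)) \<in> prod_step E'" for y
  have Q: "Q y \<longleftrightarrow> Q' y'" if "sim y y'" for y y'
    unfolding Q_def Q'_def using Suc.IH[OF that] sim_prod_step[OF that] Suc.prems(2-) k l by simp
  have ex_l: "(\<exists>v\<in>V. Q (y[l := v])) \<longleftrightarrow> (\<exists>v\<in>V'. Q' (y'[l := v]))" if "sim y y'" for y y'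
    using that l(1) Q by (rule sim_ex_iff)
  have step: "prod_step E \<subseteq> (V \<times> V) \<times> (V \<times> V)" "prod_step E' \<subseteq> (V' \<times> V') \<times> (V' \<times> V')"
    using graph(3,4) by (auto simp: prod_step_def)
  have "((x ! a, x ! b), (x ! c, x ! d)) \<in> prod_step E ^^ Suc n \<longleftrightarrow>
      (\<exists>u\<in>V. \<exists>v\<in>V. ((x ! a, x ! b), (u, v)) \<in> prod_step E ^^ n \<and> ((u, v), (x ! c, x ! d)) \<in> prod_step E)"
    using step(1) by auto
  also have "\<dots> \<longleftrightarrow> (\<exists>u\<in>V. \<exists>v\<in>V. Q (x[k := u, l := v]))"
    unfolding Q_def using k l sim_length[OF Suc.prems(1)] by simp
  also have "\<dots> \<longleftrightarrow> (\<exists>u\<in>V'. \<exists>v\<in>V'. Q' (x'[k := u, l := v]))"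
    by (rule sim_ex_iff[where Q = "\<lambda>y. \<exists>v\<in>V. Q (y[l := v])" and Q' = "\<lambda>y. \<exists>v\<in>V'. Q' (y[l := v])",
          OF Suc.prems(1) k(1) ex_l])
  also have "\<dots> \<longleftrightarrow> (\<exists>u\<in>V'. \<exists>v\<in>V'. ((x' ! a, x' ! b), (u, v)) \<in> prod_step E' ^^ n \<and>
      ((u, v), (x' ! c, x' ! d)) \<in> prod_step E')"
    unfolding Q'_def using k l sim_length[OF Suc.prems(1)] by simp
  also have "\<dots> \<longleftrightarrow> ((x' ! a, x' ! b), (x' ! c, x' ! d)) \<in> prod_step E' ^^ Suc n"
    using step(2) by auto
  finally show ?case .
qed

lemma sim_prod_rel:
  "sim x x' \<Longrightarrow> a < m \<Longrightarrow> b < m \<Longrightarrow> c < m \<Longrightarrow> d < m \<Longrightarrow>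
    ((x ! a, x ! b), (x ! c, x ! d)) \<in> prod_rel E \<longleftrightarrow> ((x' ! a, x' ! b), (x' ! c, x' ! d)) \<in> prod_rel E'"
  unfolding prod_rel_iff_relpow using sim_relpow_prod_step by blast

lemma vertices_empty_iff: "V = {} \<longleftrightarrow> V' = {}"
  by (rule V_empty_iff)

lemma connected_transfer:
  "(\<forall>u\<in>V. \<forall>v\<in>V. (u, v) \<in> E\<^sup>*) \<longleftrightarrow> (\<forall>u\<in>V'. \<forall>v\<in>V'. (u, v) \<in> E'\<^sup>*)"
proof (cases "V = {}")
  case False
  then obtain x x' where s: "sim x x'" using sim_ex by blast
  have 01: "0 < m" "1 < m" using m by auto
  obtain h where h: "bij_betw h (V \<times> V) (V' \<times> V')"
    "\<And>p. p \<in> V \<times> V \<Longrightarrow> sim (x[0 := fst p, 1 := snd p]) (x'[0 := fst (h p), 1 := snd (h p)])"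
    using sim_extend_pair[OF s 01] by blast
  have "p \<in> E\<^sup>* \<longleftrightarrow> h p \<in> E'\<^sup>*" if "p \<in> V \<times> V" for p
    using sim_relpow[OF h(2)[OF that] 01] sim_length[OF s] 01
    by (simp add: rtrancl_power prod_eq_iff)
  then have "(\<forall>p\<in>V \<times> V. p \<in> E\<^sup>*) \<longleftrightarrow> (\<forall>q\<in>h ` (V \<times> V). q \<in> E'\<^sup>*)" by auto
  then show ?thesis using bij_betw_imp_surj_on[OF h(1)] by simp
qed (use V_empty_iff in simp)

text \<open>The bijection \<open>h\<close> matches arcs with arcs, with no control over which arcs
  are related. For each arc \<open>p\<close> a further bijection \<open>g\<close>, depending on
  \<open>p\<close>, matches the arcs related to \<open>p\<close> with those related to
  \<open>h p\<close>, so the class sizes agree.\<close>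

lemma prod_classes_transfer:
  assumes conn: "conn_graph V E" "conn_graph V' E'"
  shows "card (E // prod_rel E) = card (E' // prod_rel E')"
proof (cases "V = {}")
  case False
  interpret G: conn_graph V E by fact
  interpret G': conn_graph V' E' by fact
  have ix: "0 < m" "1 < m" "2 < m" "3 < m" using m by auto
  obtain x x' where s: "sim x x'" using sim_ex False by blast
  obtain h where h: "bij_betw h (V \<times> V) (V' \<times> V')"
    "\<And>p. p \<in> V \<times> V \<Longrightarrow> sim (x[0 := fst p, 1 := snd p]) (x'[0 := fst (h p), 1 := snd (h p)])"
    using sim_extend_pair[OF s ix(1,2)] by blast
  have arc: "p \<in> E \<longleftrightarrow> h p \<in> E'" if "p \<in> V \<times> V" for p
    using sim_arc[OF h(2)[OF that] ix(1,2)] sim_length[OF s] ix by simp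
  have "bij_betw h {p \<in> V \<times> V. p \<in> E} {q \<in> V' \<times> V'. q \<in> E'}"
    using h(1) arc by (rule bij_betw_restrict_pred)
  moreover have "{p \<in> V \<times> V. p \<in> E} = E" "{q \<in> V' \<times> V'. q \<in> E'} = E'" using graph(3,4) by auto
  ultimately have hE: "bij_betw h E E'" by simp
  have class_card: "card (prod_rel E `` {p}) = card (prod_rel E' `` {h p})" if p: "p \<in> E" for p
  proof -
    have pV: "p \<in> V \<times> V" using p graph(3) by blast
    define y where "y = x[0 := fst p, 1 := snd p]"
    define y' where "y' = x'[0 := fst (h p), 1 := snd (h p)]"
    have y: "sim y y'" unfolding y_def y'_def by (rule h(2)[OF pV])
    have y01: "(y ! 0, y ! 1) = p" "(y' ! 0, y' ! 1) = h p"
      using sim_length[OF s] ix by (simp_all add: y_def y'_def)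
    obtain g where g: "bij_betw g (V \<times> V) (V' \<times> V')"
      "\<And>q. q \<in> V \<times> V \<Longrightarrow> sim (y[2 := fst q, 3 := snd q]) (y'[2 := fst (g q), 3 := snd (g q)])"
      using sim_extend_pair[OF y ix(3,4)] by blast
    have "(p, q) \<in> prod_rel E \<longleftrightarrow> (h p, g q) \<in> prod_rel E'" if q: "q \<in> V \<times> V" for q
      using sim_prod_rel[OF g(2)[OF q] ix] sim_length[OF y] ix y01 by simp
    then have "bij_betw g {q \<in> V \<times> V. (p, q) \<in> prod_rel E} {q \<in> V' \<times> V'. (h p, q) \<in> prod_rel E'}"
      using g(1) by (intro bij_betw_restrict_pred)
    moreover have "{q \<in> V \<times> V. (p, q) \<in> prod_rel E} = prod_rel E `` {p}"
      using equiv_type[OF G.equiv_prod_rel] graph(3) by auto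
    moreover have "{q \<in> V' \<times> V'. (h p, q) \<in> prod_rel E'} = prod_rel E' `` {h p}"
      using equiv_type[OF G'.equiv_prod_rel] graph(4) by auto
    ultimately show ?thesis using bij_betw_same_card[of g] by simp
  qed
  show ?thesis
    using G.equiv_prod_rel G.finite_arcs G'.equiv_prod_rel G'.finite_arcs hE class_card
    by (rule card_quotient_eqI)
next
  case True
  then have "E = {}" "E' = {}" using V_empty_iff graph(3,4) by auto
  then show ?thesis by (simp add: quotient_def)
qed

end

theorem theorem1p1:
  fixes k m :: nat
    and X :: "'a pair_pre_digraph"
    and X' :: "'b pair_pre_digraph"
  assumes "k \<ge> 1"
    and "m \<ge> 6"
    and "pair_graph X"
    and "pair_graph X'"
    and "wl_equivalent m X X'"
  shows "product_of_connected_primes k X \<longleftrightarrow> product_of_connected_primes k X'"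
proof -
  obtain \<phi> where G: "wl_equiv_graphs m X X' \<phi>"
    using assms unfolding wl_equivalent_def wl_equiv_graphs_def by blast
  have conn: "Digraph_Component.connected (with_proj X) \<longleftrightarrow> Digraph_Component.connected (with_proj X')"
    using wl_equiv_graphs.connected_transfer[OF G] wl_equiv_graphs.vertices_empty_iff[OF G]
      connected_iff[OF assms(3)] connected_iff[OF assms(4)] by simp
  \<comment> \<open>Class counts are compared only when both graphs are connected, so that the
    relations are known to be equivalences; if one graph is disconnected, so is the other, and both
    sides of the claim fail.\<close>
  have "prod_classes X = prod_classes X'"
    if "Digraph_Component.connected (with_proj X)" "Digraph_Component.connected (with_proj X')"
    using wl_equiv_graphs.prod_classes_transfer[OF G connected_imp_conn_graph(1)[OF assms(3) that(1)]
        connected_imp_conn_graph(1)[OF assms(4) that(2)]]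
    by (simp add: prod_classes_def)
  then show ?thesis
    unfolding product_of_connected_primes_iff[OF assms(3)] product_of_connected_primes_iff[OF assms(4)]
    using conn by auto
qed

end
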